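(* Let $\nu(s)=\zeta(s)\zeta''(s)-\zeta'(s)^2$. For $\delta>0$, let $N_{5/6+\delta}(T)$ denote the number of zeros of $\nu(s)$, counted with multiplicity, in the region $|\operatorname{Im}(s)|\le T$, $5/6+\delta\le \operatorname{Re}(s)$. Then, for each fixed $\delta>0$, as $T\to\infty$, $$N_{5/6+\delta}(T)\ll_\delta T,$$ where the implied constant depends only on $\delta$.
   Context: $\zeta(s)$ denotes the Riemann zeta function (meromorphically continued to $\mathbb{C}$), and $\zeta'$, $\zeta''$ are its first and second derivatives. *)

theory Defs
  imports "HOL-Complex_Analysis.Complex_Analysis"
begin

section \<open>The Riemann zeta function\<close>

definition is_zeta_continuation :: "(complex \<Rightarrow> complex) \<Rightarrow> bool" where
  "is_zeta_continuation f \<longleftrightarrow>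
     f holomorphic_on (- {1}) \<and>
     (\<forall>s. Re s > 1 \<longrightarrow> (\<lambda>n. of_nat (Suc n) powr (- s)) sums f s)"

text \<open>
  The value at the pole is not constrained by the continuation; it is fixed to be 0 so that
  the description is unique. Existence and uniqueness are established below.
\<close>
definition zeta :: "complex \<Rightarrow> complex" where
  "zeta = (THE f. is_zeta_continuation f \<and> f 1 = 0)"

subsection \<open>Uniqueness\<close>

lemma is_zeta_continuation_unique:
  assumes "is_zeta_continuation f" "is_zeta_continuation g" "s \<noteq> 1"
  shows "f s = g s"
proof -
  have f: "f holomorphic_on (- {1})" and g: "g holomorphic_on (- {1})"
    using assms by (auto simp: is_zeta_continuation_def)
  have eq: "f z = g z" if "Re z > 1" for z
    using assms that unfolding is_zeta_continuation_def by (metis sums_unique2)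
  have conn: "connected (- {1::complex})"
    by (rule connected_punctured_universe) simp
  have "f s - g s = 0"
  proof (rule analytic_continuation[where f = "\<lambda>z. f z - g z" and S = "- {1}"
          and U = "{z. Re z > 1}" and \<xi> = 2])
    show "(\<lambda>z. f z - g z) holomorphic_on (- {1})" using f g by (intro holomorphic_intros)
    show "(2::complex) islimpt {z. Re z > 1}"
      by (rule interior_limit_point) (simp add: interior_open open_halfspace_Re_gt)
  qed (use conn eq assms(3) in auto)
  thus ?thesis by simp
qed

subsection \<open>Existence\<close>

definition zpow :: "real \<Rightarrow> complex \<Rightarrow> complex" where
  "zpow x s = exp (- (s * of_real (ln x)))"

lemma norm_zpow: "x > 0 \<Longrightarrow> norm (zpow x s) = x powr (- Re s)"
  by (simp add: zpow_def powr_def norm_exp_eq_Re)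

lemma zpow_of_nat: "n > 0 \<Longrightarrow> zpow (real n) s = of_nat n powr (- s)"
  by (simp add: zpow_def powr_def Ln_of_nat)

lemma zpow_mult: "x > 0 \<Longrightarrow> y > 0 \<Longrightarrow> zpow (x * y) s = zpow x s * zpow y s"
  by (simp add: zpow_def ln_mult exp_add [symmetric] algebra_simps)

lemma zpow_deriv:
  assumes "x > 0"
  shows "((\<lambda>x. zpow x s) has_vector_derivative (- s * zpow x (s + 1))) (at x within A)"
proof -
  have e: "exp (complex_of_real (ln x)) = of_real x"
    using assms by (metis exp_ln exp_of_real)
  have "((\<lambda>x. - (s * complex_of_real (ln x))) has_vector_derivative (- (s * of_real (1 / x))))
      (at x within A)"
    using assms by (auto intro!: derivative_eq_intros simp: divide_inverse)
  from field_vector_diff_chain_within[OF this, of exp "exp (- (s * of_real (ln x)))"]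
  have "((\<lambda>x. zpow x s) has_vector_derivative
      (- (s * of_real (1 / x)) * exp (- (s * of_real (ln x))))) (at x within A)"
    by (simp add: zpow_def o_def has_field_derivative_at_within DERIV_exp)
  moreover have "- (s * of_real (1 / x)) * exp (- (s * of_real (ln x))) = - s * zpow x (s + 1)"
    using assms e by (simp add: zpow_def distrib_right exp_diff exp_minus field_simps)
  ultimately show ?thesis by simp
qed

lemma zpow_holomorphic [holomorphic_intros]:
  "f holomorphic_on A \<Longrightarrow> (\<lambda>s. zpow x (f s)) holomorphic_on A"
  unfolding zpow_def by (intro holomorphic_intros)

text \<open>Weierstrass test adapted to series dominated by a generalized harmonic series.\<close>
lemma dominated_series:
  fixes f :: "nat \<Rightarrow> complex \<Rightarrow> complex" and K b :: "complex \<Rightarrow> real"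
  assumes S: "open S" and hol: "\<And>n. f n holomorphic_on S"
    and K: "continuous_on S K" and b: "continuous_on S b"
    and b1: "\<And>s. s \<in> S \<Longrightarrow> b s > 1"
    and bd: "\<And>n s. s \<in> S \<Longrightarrow> norm (f n s) \<le> K s * real (Suc n) powr (- b s)"
  shows "(\<lambda>s. \<Sum>n. f n s) holomorphic_on S" and "\<And>s. s \<in> S \<Longrightarrow> summable (\<lambda>n. f n s)"
proof -
  have summ: "summable (\<lambda>n. C * real (Suc n) powr (- a))" if "a > 1" for a C :: real
    using that summable_real_powr_iff[of "-a"] summable_Suc_iff[of "\<lambda>n. real n powr (-a)"]
    by (intro summable_mult) simp
  show "summable (\<lambda>n. f n s)" if "s \<in> S" for s
    by (rule summable_comparison_test'[OF summ[of "b s" "K s"]]) (use that b1 bd in auto)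
  show "(\<lambda>s. \<Sum>n. f n s) holomorphic_on S"
  proof (rule holomorphic_uniform_sequence[OF S, where f = "\<lambda>N s. \<Sum>n<N. f n s"])
    show "(\<lambda>s. \<Sum>n<N. f n s) holomorphic_on S" for N
      using hol by (intro holomorphic_intros)
    fix x assume "x \<in> S"
    then obtain d where d: "d > 0" "cball x d \<subseteq> S"
      using S open_contains_cball by blast
    have ne: "cball x d \<noteq> {}" using d by auto
    obtain p where p: "p \<in> cball x d" "\<And>y. y \<in> cball x d \<Longrightarrow> K y \<le> K p"
      using continuous_attains_sup[OF compact_cball ne continuous_on_subset[OF K d(2)]] by blast
    obtain q where q: "q \<in> cball x d" "\<And>y. y \<in> cball x d \<Longrightarrow> b q \<le> b y"
      using continuous_attains_inf[OF compact_cball ne continuous_on_subset[OF b d(2)]] by blast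
    have "uniform_limit (cball x d) (\<lambda>N s. \<Sum>n<N. f n s) (\<lambda>s. \<Sum>n. f n s) sequentially"
    proof (rule Weierstrass_m_test[where M = "\<lambda>n. \<bar>K p\<bar> * real (Suc n) powr (- b q)"])
      show "summable (\<lambda>n. \<bar>K p\<bar> * real (Suc n) powr (- b q))"
        using q d b1 by (intro summ) auto
      fix n y assume y: "y \<in> cball x d"
      have "norm (f n y) \<le> K y * real (Suc n) powr (- b y)" using y d bd by auto
      also have "\<dots> \<le> \<bar>K p\<bar> * real (Suc n) powr (- b q)"
        using p(2)[OF y] q(2)[OF y] by (intro mult_mono powr_mono) auto
      finally show "norm (f n y) \<le> \<bar>K p\<bar> * real (Suc n) powr (- b q)" .
    qed
    thus "\<exists>d>0. cball x d \<subseteq> S \<and>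
        uniform_limit (cball x d) (\<lambda>N s. \<Sum>n<N. f n s) (\<lambda>s. \<Sum>n. f n s) sequentially"
      using d by blast
  qed
qed

fun zdiff :: "nat \<Rightarrow> real \<Rightarrow> complex \<Rightarrow> complex" where
  "zdiff 0 x s = zpow x s"
| "zdiff (Suc m) x s = zdiff m x s - zdiff m (x + 1) s"

lemma zdiff_holomorphic: "zdiff m x holomorphic_on A"
proof (induction m arbitrary: x)
  case 0
  have "zdiff 0 x = (\<lambda>s. zpow x s)" by auto
  thus ?case by (auto intro!: holomorphic_intros)
next
  case (Suc m)
  have "zdiff (Suc m) x = (\<lambda>s. zdiff m x s - zdiff m (x + 1) s)" by auto
  thus ?case using Suc by (auto intro!: holomorphic_intros)
qed

lemma zdiff_deriv:
  "x > 0 \<Longrightarrow> ((\<lambda>x. zdiff m x s) has_vector_derivative (- s * zdiff m x (s + 1))) (at x within A)"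
proof (induction m arbitrary: x A)
  case 0
  thus ?case using zpow_deriv by simp
next
  case (Suc m)
  have 1: "((\<lambda>x. x + 1) has_vector_derivative 1) (at x within A)"
    by (auto intro!: derivative_eq_intros)
  have "((\<lambda>x. zdiff m (x + 1) s) has_vector_derivative (- s * zdiff m (x + 1) (s + 1)))
      (at x within A)"
    using vector_diff_chain_within[OF 1 Suc.IH[of "x + 1" "(\<lambda>x. x + 1) ` A"]] Suc.prems
    by (simp add: o_def)
  from has_vector_derivative_diff[OF Suc.IH[OF Suc.prems] this]
  show ?case by (simp add: algebra_simps)
qed

lemma vector_mvt_bound:
  fixes f :: "real \<Rightarrow> complex"
  assumes "a \<le> c" and "\<And>y. y \<in> {a..c} \<Longrightarrow> (f has_vector_derivative f' y) (at y within {a..c})"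
    and "\<And>y. y \<in> {a..c} \<Longrightarrow> norm (f' y) \<le> B"
  shows "norm (f c - f a) \<le> B * (c - a)"
proof -
  have "norm (f c - f a) \<le> B * norm (c - a)"
    using assms
    by (intro differentiable_bound[where S = "{a..c}" and f' = "\<lambda>y h. h *\<^sub>R f' y"])
       (auto simp: has_vector_derivative_def mult.commute[of B] intro!: onorm_le mult_left_mono)
  thus ?thesis using assms(1) by simp
qed

lemma zdiff_bound:
  assumes "x > 0" "Re s + real m \<ge> 0"
  shows "norm (zdiff m x s) \<le> (\<Prod>j<m. norm (s + of_nat j)) * x powr (- (Re s + real m))"
  using assms
proof (induction m arbitrary: x s)
  case 0
  thus ?case by (simp add: norm_zpow)
next
  case (Suc m)
  let ?C = "norm s * (\<Prod>j<m. norm (s + 1 + of_nat j))"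
  have "norm (zdiff m (x + 1) s - zdiff m x s)
      \<le> (?C * x powr (- (Re s + real (Suc m)))) * ((x + 1) - x)"
  proof (rule vector_mvt_bound[where f' = "\<lambda>y. - s * zdiff m y (s + 1)"])
    fix y assume y: "y \<in> {x..x + 1}"
    show "((\<lambda>x. zdiff m x s) has_vector_derivative - s * zdiff m y (s + 1))
        (at y within {x..x + 1})"
      using y Suc.prems by (intro zdiff_deriv) auto
    have "norm (zdiff m y (s + 1))
        \<le> (\<Prod>j<m. norm (s + 1 + of_nat j)) * y powr (- (Re (s + 1) + real m))"
      using y Suc.prems by (intro Suc.IH) auto
    also have "\<dots> \<le> (\<Prod>j<m. norm (s + 1 + of_nat j)) * x powr (- (Re s + real (Suc m)))"
      using y Suc.prems
      by (intro mult_left_mono prod_nonneg) (auto intro!: powr_mono2' simp: add_ac)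
    finally have "norm s * norm (zdiff m y (s + 1))
        \<le> norm s * ((\<Prod>j<m. norm (s + 1 + of_nat j)) * x powr (- (Re s + real (Suc m))))"
      by (rule mult_left_mono) simp
    thus "norm (- s * zdiff m y (s + 1)) \<le> ?C * x powr (- (Re s + real (Suc m)))"
      by (simp add: norm_mult mult_ac)
  qed simp
  moreover have "?C = (\<Prod>j<Suc m. norm (s + of_nat j))"
    by (subst prod.lessThan_Suc_shift) (simp add: add_ac)
  ultimately show ?case
    by (simp add: norm_minus_commute)
qed

text \<open>Continuation to \<open>Re s > 0\<close> by comparison with an integral.\<close>

definition zterm :: "nat \<Rightarrow> complex \<Rightarrow> complex" where
  "zterm n s = zpow (real (Suc n)) s
     - (zpow (real (Suc n)) (s - 1) - zpow (real (Suc n) + 1) (s - 1)) / (s - 1)"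

lemma zterm_bound:
  assumes "Re s > 0" "s \<noteq> 1"
  shows "norm (zterm n s) \<le> norm s * real (Suc n) powr (- (Re s + 1))"
proof -
  define x where "x = real (Suc n)"
  have x: "x > 0" by (simp add: x_def)
  define h where "h = (\<lambda>y. of_real (y - x) * zpow x s + zpow y (s - 1) / (s - 1))"
  have "norm (h (x + 1) - h x) \<le> norm s * x powr (- (Re s + 1)) * ((x + 1) - x)"
  proof (rule vector_mvt_bound[where f' = "\<lambda>y. zpow x s - zpow y s"])
    fix y assume y: "y \<in> {x..x + 1}"
    have "((\<lambda>y. of_real (y - x) * zpow x s) has_vector_derivative zpow x s)
        (at y within {x..x + 1})"
      by (auto intro!: derivative_eq_intros)
    moreover have "((\<lambda>y. zpow y (s - 1) / (s - 1)) has_vector_derivative - zpow y s)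
        (at y within {x..x + 1})"
      using has_vector_derivative_divide[OF zpow_deriv[of y "s - 1" "{x..x + 1}"], of "s - 1"]
        y x assms(2) by (simp add: minus_divide_left [symmetric] minus_mult_left [symmetric]
          nonzero_mult_div_cancel_left del: minus_mult_left minus_diff_eq mult_minus_left)
    ultimately show "(h has_vector_derivative zpow x s - zpow y s) (at y within {x..x + 1})"
      unfolding h_def by (auto dest: has_vector_derivative_add)
    have "norm (zpow y s - zpow x s) \<le> norm s * x powr (- (Re s + 1)) * (y - x)"
    proof (rule vector_mvt_bound[where f' = "\<lambda>y. - s * zpow y (s + 1)"])
      fix z assume z: "z \<in> {x..y}"
      show "((\<lambda>x. zpow x s) has_vector_derivative - s * zpow z (s + 1)) (at z within {x..y})"
        using z x by (intro zpow_deriv) auto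
      have "z powr (- (Re s + 1)) \<le> x powr (- (Re s + 1))"
        using z x assms(1) by (intro powr_mono2') auto
      thus "norm (- s * zpow z (s + 1)) \<le> norm s * x powr (- (Re s + 1))"
        using z x by (auto simp: norm_mult norm_zpow intro!: mult_left_mono)
    qed (use y in auto)
    also have "\<dots> \<le> norm s * x powr (- (Re s + 1)) * 1"
      using y by (intro mult_left_mono) auto
    finally show "norm (zpow x s - zpow y s) \<le> norm s * x powr (- (Re s + 1))"
      by (simp add: norm_minus_commute)
  qed simp
  moreover have "h (x + 1) - h x = zterm n s"
    using assms(2) by (simp add: h_def zterm_def x_def diff_divide_distrib)
  ultimately show ?thesis by (simp add: x_def)
qed

definition zeta_right :: "complex \<Rightarrow> complex" where
  "zeta_right s = 1 / (s - 1) + (\<Sum>n. zterm n s)"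

lemma zeta_right_holomorphic: "zeta_right holomorphic_on ({s. Re s > 0} - {1})"
  and zterm_summable: "Re s > 0 \<Longrightarrow> s \<noteq> 1 \<Longrightarrow> summable (\<lambda>n. zterm n s)"
proof -
  let ?S = "{s::complex. Re s > 0} - {1}"
  have o: "open ?S" by (intro open_Diff open_halfspace_Re_gt) auto
  have h: "zterm n holomorphic_on ?S" for n
    unfolding zterm_def by (intro holomorphic_intros) auto
  have bd: "norm (zterm n s) \<le> norm s * real (Suc n) powr (- (Re s + 1))" if "s \<in> ?S" for n s
    using zterm_bound that by auto
  note D = dominated_series[where f = zterm and K = norm and b = "\<lambda>s. Re s + 1", OF o h _ _ _ bd]
  have "(\<lambda>s. \<Sum>n. zterm n s) holomorphic_on ?S"
    by (rule D) (auto intro!: continuous_intros)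
  thus "zeta_right holomorphic_on ?S"
    unfolding zeta_right_def by (intro holomorphic_intros) auto
  show "summable (\<lambda>n. zterm n s)" if "Re s > 0" "s \<noteq> 1"
    using that by (intro D) (auto intro!: continuous_intros)
qed

lemma zpow_summable:
  assumes "Re s > 1"
  shows "summable (\<lambda>n. zpow (real (Suc n)) s)"
proof -
  have "summable (\<lambda>n. real (Suc n) powr (- Re s))"
    using assms summable_real_powr_iff[of "- Re s"]
      summable_Suc_iff[of "\<lambda>n. real n powr (- Re s)"] by simp
  thus ?thesis
    by (intro summable_norm_cancel[of "\<lambda>n. zpow (real (Suc n)) s"]) (simp add: norm_zpow)
qed

lemma zpow_tendsto:
  assumes "Re s > 0"
  shows "(\<lambda>n. zpow (real (Suc n)) s) \<longlonglongrightarrow> 0"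
proof -
  have "(\<lambda>n. real (Suc n) powr (- Re s)) \<longlonglongrightarrow> 0"
    by (rule tendsto_neg_powr)
       (use assms in \<open>auto intro!: filterlim_compose[OF filterlim_real_sequentially filterlim_Suc]
              simp del: of_nat_Suc\<close>)
  thus ?thesis
    by (intro tendsto_norm_zero_cancel[of "\<lambda>n. zpow (real (Suc n)) s"]) (simp add: norm_zpow)
qed

lemma zeta_right_eq:
  assumes "Re s > 1"
  shows "(\<lambda>n. zpow (real (Suc n)) s) sums zeta_right s"
proof -
  have s: "s \<noteq> 1" using assms by auto
  have "(\<lambda>n. zpow (real (Suc n)) (s - 1)) \<longlonglongrightarrow> 0"
    using assms by (intro zpow_tendsto) auto
  from telescope_sums'[OF this]
  have "(\<lambda>n. zpow (real (Suc n)) (s - 1) - zpow (real (Suc n) + 1) (s - 1)) sums 1"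
    by (simp add: zpow_def add_ac)
  hence "(\<lambda>n. (zpow (real (Suc n)) (s - 1) - zpow (real (Suc n) + 1) (s - 1)) / (s - 1))
      sums (1 / (s - 1))"
    by (rule sums_divide)
  from sums_add[OF this summable_sums[OF zterm_summable[of s]]] s assms
  show ?thesis by (simp add: zterm_def zeta_right_def)
qed

text \<open>Continuation of the alternating series by repeated averaging.\<close>

definition zalt :: "nat \<Rightarrow> complex \<Rightarrow> complex" where
  "zalt m s = (\<Sum>n. (-1) ^ n * zdiff m (real (Suc n)) s)"

definition zeta_alt :: "nat \<Rightarrow> complex \<Rightarrow> complex" where
  "zeta_alt m s = (\<Sum>j<m. zdiff j 1 s / 2 ^ Suc j) + zalt m s / 2 ^ m"

lemma zalt_holomorphic: "zalt m holomorphic_on {s. Re s > 1 - real m}"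
  and zalt_summable: "Re s > 1 - real m \<Longrightarrow> summable (\<lambda>n. (-1) ^ n * zdiff m (real (Suc n)) s)"
proof -
  let ?S = "{s::complex. Re s > 1 - real m}"
  have h: "(\<lambda>s. (-1) ^ n * zdiff m (real (Suc n)) s) holomorphic_on ?S" for n
    by (intro holomorphic_intros zdiff_holomorphic)
  have bd: "norm ((-1) ^ n * zdiff m (real (Suc n)) s)
      \<le> (\<Prod>j<m. norm (s + of_nat j)) * real (Suc n) powr (- (Re s + real m))" if "s \<in> ?S" for n s
    using zdiff_bound[of "real (Suc n)" s m] that by (simp add: norm_mult norm_power)
  note D = dominated_series[where f = "\<lambda>n s. (-1) ^ n * zdiff m (real (Suc n)) s"
      and K = "\<lambda>s. \<Prod>j<m. norm (s + of_nat j)" and b = "\<lambda>s. Re s + real m",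
      OF open_halfspace_Re_gt h _ _ _ bd]
  show "zalt m holomorphic_on ?S"
    unfolding zalt_def by (rule D) (auto intro!: continuous_intros)
  show "summable (\<lambda>n. (-1) ^ n * zdiff m (real (Suc n)) s)" if "Re s > 1 - real m"
    using that by (intro D) (auto intro!: continuous_intros)
qed

lemma zeta_alt_holomorphic: "zeta_alt m holomorphic_on {s. Re s > 1 - real m}"
  unfolding zeta_alt_def
  by (intro holomorphic_intros zdiff_holomorphic zalt_holomorphic) auto

lemma zeta_alt_Suc:
  assumes "Re s > 1 - real m"
  shows "zeta_alt (Suc m) s = zeta_alt m s"
proof -
  define a where "a = (\<lambda>n. (-1) ^ n * zdiff m (real (Suc n)) s)"
  have a: "a sums zalt m s"
    unfolding a_def zalt_def by (rule summable_sums[OF zalt_summable[OF assms]])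
  hence "(\<lambda>n. a (Suc n)) sums (zalt m s - a 0)"
    by (subst sums_Suc_iff) simp
  from sums_add[OF a this]
  have "(\<lambda>n. (-1) ^ n * zdiff (Suc m) (real (Suc n)) s) sums (zalt m s + (zalt m s - a 0))"
    by (simp add: a_def algebra_simps)
  hence "zalt (Suc m) s = 2 * zalt m s - zdiff m 1 s"
    unfolding zalt_def[of "Suc m"] by (simp add: sums_iff a_def)
  hence "zalt (Suc m) s / 2 ^ Suc m = zalt m s / 2 ^ m - zdiff m 1 s / 2 ^ Suc m"
    by (simp add: diff_divide_distrib)
  thus ?thesis by (simp add: zeta_alt_def)
qed

lemma zeta_alt_eq:
  assumes "Re s > 1 - real m" "m \<le> k"
  shows "zeta_alt k s = zeta_alt m s"
  using assms(2,1) by (induction k rule: dec_induct) (auto simp: zeta_alt_Suc)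

lemma zeta_alt_0:
  assumes "Re s > 1"
  shows "zeta_alt 0 s = (1 - 2 * zpow 2 s) * zeta_right s"
proof -
  let ?a = "\<lambda>n. zpow (real (Suc n)) s"
  have a: "?a sums zeta_right s" by (rule zeta_right_eq[OF assms])
  have "(\<lambda>n. (-1) ^ n * ?a n) sums zeta_alt 0 s"
    using summable_sums[OF zalt_summable[of 0 s]] assms by (simp add: zeta_alt_def zalt_def)
  from sums_group[OF sums_diff[OF a this], of 2]
  have "(\<lambda>n. \<Sum>k\<in>{n * 2..<n * 2 + 2}. ?a k - (-1) ^ k * ?a k) sums
      (zeta_right s - zeta_alt 0 s)"
    by simp
  moreover have "(\<Sum>k\<in>{n * 2..<n * 2 + 2}. ?a k - (-1) ^ k * ?a k)
      = 2 * zpow (real (Suc (2 * n + 1))) s" for n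
  proof -
    have "{n * 2..<n * 2 + 2} = {2 * n, 2 * n + 1}" by auto
    thus ?thesis by simp
  qed
  ultimately have "(\<lambda>n. 2 * zpow (real (Suc (2 * n + 1))) s) sums (zeta_right s - zeta_alt 0 s)"
    by simp
  moreover have "zpow (real (Suc (2 * n + 1))) s = zpow 2 s * ?a n" for n
    using zpow_mult[of 2 "real (Suc n)" s] by (simp add: algebra_simps)
  ultimately have "(\<lambda>n. 2 * zpow 2 s * ?a n) sums (zeta_right s - zeta_alt 0 s)"
    by (simp add: mult.assoc)
  moreover have "(\<lambda>n. 2 * zpow 2 s * ?a n) sums (2 * zpow 2 s * zeta_right s)"
    by (rule sums_mult[OF a])
  ultimately have "zeta_right s - zeta_alt 0 s = 2 * zpow 2 s * zeta_right s"
    by (rule sums_unique2)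
  thus ?thesis by (simp add: algebra_simps)
qed

lemma zeta_alt_1:
  assumes "Re s > 0" "s \<noteq> 1"
  shows "zeta_alt 1 s = (1 - 2 * zpow 2 s) * zeta_right s"
proof -
  let ?S = "{s::complex. Re s > 0} - {1}"
  let ?h = "\<lambda>s. zeta_alt 1 s - (1 - 2 * zpow 2 s) * zeta_right s"
  have o: "open ?S" by (intro open_Diff open_halfspace_Re_gt) auto
  have "?h s = 0"
  proof (rule analytic_continuation[where f = ?h and S = ?S and U = "{z. Re z > 1}" and \<xi> = 2])
    show "?h holomorphic_on ?S"
      using holomorphic_on_subset[OF zeta_alt_holomorphic[of 1], of ?S]
      by (intro holomorphic_intros zeta_right_holomorphic) auto
    show "connected ?S"
      by (intro connected_open_delete open_halfspace_Re_gt convex_connected convex_halfspace_Re_gt)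
         simp
    show "(2::complex) islimpt {z. Re z > 1}"
      by (rule interior_limit_point) (simp add: interior_open open_halfspace_Re_gt)
    show "?h z = 0" if "z \<in> {z. Re z > 1}" for z
      using that zeta_alt_Suc[of 0 z] zeta_alt_0[of z] by simp
  qed (use o assms in auto)
  thus ?thesis by simp
qed

lemma zpow_2_neq: "Re s < 1 \<Longrightarrow> 1 - 2 * zpow 2 s \<noteq> 0"
proof
  assume "Re s < 1" "1 - 2 * zpow 2 s = 0"
  hence "zpow 2 s = 1 / 2" by (simp add: eq_divide_eq mult.commute)
  hence "norm (zpow 2 s) = 1 / 2" by (simp only: norm_divide) simp
  hence "2 powr (- Re s) = (2::real) powr (- 1)" by (simp add: norm_zpow powr_minus field_simps)
  moreover have "(2::real) powr (- 1) < 2 powr (- Re s)"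
    using \<open>Re s < 1\<close> by (intro powr_less_mono) auto
  ultimately show False by linarith
qed

lemma is_zeta_continuation_exists: "\<exists>f. is_zeta_continuation f \<and> f 1 = 0"
proof -
  define M where "M = (\<lambda>s::complex. nat \<lceil>2 - Re s\<rceil>)"
  have M: "Re s > 1 - real (M s)" for s
    unfolding M_def by linarith
  define E where "E = (\<lambda>s. zeta_alt (M s) s)"
  have E: "E s = zeta_alt m s" if "Re s > 1 - real m" for m s
    using that M[of s] zeta_alt_eq[of _ s] unfolding E_def by (metis nat_le_linear)
  have Ehol: "E holomorphic_on A" for A
  proof -
    have "E field_differentiable at s" for s
    proof -
      have "E holomorphic_on {z. Re z > 1 - real (M s)}"
        using zeta_alt_holomorphic[of "M s"] by (rule holomorphic_transform) (simp add: E)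
      thus ?thesis using M[of s]
        by (intro holomorphic_on_imp_differentiable_at[OF _ open_halfspace_Re_gt]) auto
    qed
    thus ?thesis by (simp add: holomorphic_on_def field_differentiable_at_within)
  qed
  define f where "f = (\<lambda>s. if s = 1 then 0 else if Re s > 0 then zeta_right s
     else E s / (1 - 2 * zpow 2 s))"
  have 1: "f holomorphic_on ({s. Re s > 0} - {1})"
    using zeta_right_holomorphic by (rule holomorphic_transform) (auto simp: f_def)
  have "(\<lambda>s. E s / (1 - 2 * zpow 2 s)) holomorphic_on {s. Re s < 1}"
    using zpow_2_neq by (intro holomorphic_intros Ehol) auto
  hence 2: "f holomorphic_on {s. Re s < 1}"
  proof (rule holomorphic_transform)
    fix s :: complex assume "s \<in> {s. Re s < 1}"
    thus "E s / (1 - 2 * zpow 2 s) = f s"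
      using zpow_2_neq[of s] zeta_alt_1[of s] E[of 1 s] by (auto simp: f_def field_simps)
  qed
  have "f holomorphic_on (({s. Re s > 0} - {1}) \<union> {s. Re s < 1})"
    by (rule holomorphic_on_Un[OF 1 2])
       (auto intro!: open_Diff open_halfspace_Re_gt open_halfspace_Re_lt)
  moreover have "(({s. Re s > 0} - {1}) \<union> {s. Re s < 1}) = - {1::complex}"
    by auto
  moreover have "(\<lambda>n. of_nat (Suc n) powr (- s)) sums f s" if "Re s > 1" for s
    using zeta_right_eq[OF that] that zpow_of_nat[of "Suc _" s] by (auto simp: f_def)
  ultimately have "is_zeta_continuation f" by (simp add: is_zeta_continuation_def)
  thus ?thesis by (auto intro!: exI[of _ f] simp: f_def)
qed

theorem is_zeta_continuation_zeta: "is_zeta_continuation zeta" and zeta_1: "zeta 1 = 0"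
proof -
  have "\<exists>!f. is_zeta_continuation f \<and> f 1 = 0"
    using is_zeta_continuation_exists is_zeta_continuation_unique
    by (intro ex_ex1I) (auto simp: fun_eq_iff, metis)
  from theI'[OF this] show "is_zeta_continuation zeta" "zeta 1 = 0"
    by (auto simp: zeta_def)
qed

section \<open>The function \<open>\<nu>\<close> and its zeros\<close>

definition nu :: "complex \<Rightarrow> complex" where
  "nu s = zeta s * (deriv ^^ 2) zeta s - (deriv zeta s) ^ 2"

text \<open>
  The point \<open>s = 1\<close> has to be excluded explicitly: it is a pole of \<open>\<nu>\<close>, and the value that
  the total function \<open>nu\<close> takes there is an artefact.
\<close>
definition nu_zeros :: "real \<Rightarrow> real \<Rightarrow> complex set" where
  "nu_zeros \<sigma> T = {s. s \<noteq> 1 \<and> nu s = 0 \<and> \<bar>Im s\<bar> \<le> T \<and> \<sigma> \<le> Re s}"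

text \<open>
  \<open>zorder\<close> is integer-valued, but it is positive at a zero in \<open>nu_zeros\<close> since \<open>\<nu>\<close> is
  holomorphic there and not identically zero. The sum is the true count only when \<open>nu_zeros\<close>
  is finite.
\<close>
definition nu_count :: "real \<Rightarrow> real \<Rightarrow> nat" where
  "nu_count \<sigma> T = (\<Sum>s\<in>nu_zeros \<sigma> T. nat (zorder nu s))"

end

theory Submission
  imports Defs "HOL-Real_Asymp.Real_Asymp"
begin

text \<open>
  Put \<open>q s = (s - 1) / (s + 1)\<close> and \<open>Z = q \<zeta>\<close>, so that \<open>q ^ 4 \<nu>\<close> is holomorphic for
  \<open>Re s > 0\<close> and is a quadratic expression in \<open>Z\<close>, \<open>Z'\<close>, \<open>Z''\<close>. On every vertical line with
  \<open>Re s \<ge> 5/6\<close> the mean square of \<open>Z\<close> over \<open>[-T, T]\<close> is \<open>O(T)\<close>: for \<open>T = k\<^sup>2\<close> and \<open>N = k\<^sup>3\<close>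
  the partial sum of length \<open>N\<close> approximates \<open>\<zeta>\<close> with an error of bounded mean square, and its own
  mean square is at most \<open>8 T\<close> plus off-diagonal terms of size \<open>O(N powr (2/3)) = O(T)\<close>. By
  Cauchy's formula the same holds for \<open>Z'\<close> and \<open>Z''\<close>, hence the mean of \<open>|q ^ 4 \<nu>|\<close> is \<open>O(T)\<close>.
  On a line \<open>Re s = c\<close> far to the right, \<open>\<nu> s\<close> is close to \<open>(ln 2)\<^sup>2 2 powr (-s)\<close> and so
  \<open>q ^ 4 \<nu>\<close> is bounded away from 0 there. Jensen's inequality therefore bounds the number of zeros in
  a disc about \<open>c + i t\<close> by a constant times the mean of \<open>|q ^ 4 \<nu>|\<close> over a larger concentric
  circle. Integrating this over \<open>t\<close> gives the claim.
\<close>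

section \<open>Jensen's inequality\<close>

lemma norm_circlepath_minus: "\<rho> \<ge> 0 \<Longrightarrow> norm (circlepath w \<rho> x - w) = \<rho>"
  by (simp add: circlepath norm_mult norm_exp_eq_Re)

lemma circlepath_in_cball: "\<rho> \<ge> 0 \<Longrightarrow> circlepath w \<rho> x \<in> cball w \<rho>"
  using norm_circlepath_minus[of \<rho> w x] by (simp add: dist_norm norm_minus_commute)

lemma continuous_on_circle:
  assumes "continuous_on (cball w \<rho>) f" "\<rho> \<ge> 0"
  shows "continuous_on A (\<lambda>x. f (circlepath w \<rho> x))"
  using circlepath_in_cball[OF assms(2), of w] unfolding circlepath
  by (intro continuous_on_compose2[OF assms(1)] continuous_intros) auto

text \<open>Cauchy's formula for derivatives, estimated by the mean of the modulus instead of its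
  maximum, because only means of zeta are under control. The case \<open>k = 0\<close> is the mean
  value inequality needed for Jensen's argument.\<close>

lemma norm_higher_deriv_le_circle_mean:
  assumes "f holomorphic_on S" "open S" "cball w \<rho> \<subseteq> S" "\<rho> > 0"
  shows "norm ((deriv ^^ k) f w)
    \<le> fact k / \<rho> ^ k * integral {0..1} (\<lambda>x. norm (f (circlepath w \<rho> x)))"
proof -
  let ?g = "\<lambda>x. f (circlepath w \<rho> x) / (circlepath w \<rho> x - w) ^ Suc k *
      vector_derivative (circlepath w \<rho>) (at x within {0..1})"
  have hol: "f holomorphic_on cball w \<rho>" using assms holomorphic_on_subset by blast
  have cont: "continuous_on (cball w \<rho>) f" by (rule holomorphic_on_imp_continuous_on[OF hol])
  have "((\<lambda>u. f u / (u - w) ^ Suc k) has_contour_integral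
      2 * pi * \<i> / fact k * (deriv ^^ k) f w) (circlepath w \<rho>)"
    using assms(4) hol cont
    by (intro Cauchy_has_contour_integral_higher_derivative_circlepath)
       (auto intro: holomorphic_on_subset)
  hence g: "(?g has_integral 2 * pi * \<i> / fact k * (deriv ^^ k) f w) {0..1}"
    by (simp add: has_contour_integral_def)
  have contf: "continuous_on {0..1} (\<lambda>x. norm (f (circlepath w \<rho> x)))"
    using assms(4) by (intro continuous_on_norm continuous_on_circle cont) simp
  have "norm (integral {0..1} ?g)
      \<le> integral {0..1} (\<lambda>x. 2 * pi / \<rho> ^ k * norm (f (circlepath w \<rho> x)))"
  proof (rule integral_norm_bound_integral)
    show "?g integrable_on {0..1}" using g by blast
    show "(\<lambda>x. 2 * pi / \<rho> ^ k * norm (f (circlepath w \<rho> x))) integrable_on {0..1}"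
      by (intro integrable_continuous_interval continuous_intros contf)
    fix x :: real assume "x \<in> {0..1}"
    hence "norm (?g x) = norm (f (circlepath w \<rho> x)) / \<rho> ^ Suc k * (2 * pi * \<rho>)"
      using assms(4) vector_derivative_circlepath01[of x w \<rho>]
      by (simp add: norm_mult norm_divide norm_power norm_circlepath_minus norm_exp_eq_Re del: power_Suc)
    thus "norm (?g x) \<le> 2 * pi / \<rho> ^ k * norm (f (circlepath w \<rho> x))"
      using assms(4) by (simp add: field_simps)
  qed
  moreover have "integral {0..1} ?g = 2 * pi * \<i> / fact k * (deriv ^^ k) f w"
    using g by (rule integral_unique)
  ultimately have "2 * pi / fact k * norm ((deriv ^^ k) f w)
      \<le> 2 * pi / \<rho> ^ k * integral {0..1} (\<lambda>x. norm (f (circlepath w \<rho> x)))"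
    by (simp add: norm_mult norm_divide)
  thus ?thesis using assms(4) by (simp add: field_simps)
qed

text \<open>Cauchy-Schwarz on the unit interval: integrate the square of \<open>u x - A\<close>,
  where \<open>A\<close> is the mean of \<open>u\<close>.\<close>

lemma power2_integral_le:
  fixes u :: "real \<Rightarrow> real"
  assumes "continuous_on {0..1} u"
  shows "(integral {0..1} u)\<^sup>2 \<le> integral {0..1} (\<lambda>x. (u x)\<^sup>2)"
proof -
  define A where "A = integral {0..1} u"
  have u: "u integrable_on {0..1}" and u2: "(\<lambda>x. (u x)\<^sup>2) integrable_on {0..1}"
    by (intro integrable_continuous_interval continuous_intros assms)+
  have "integral {0..1} (\<lambda>x. 2 * A * u x) \<le> integral {0..1} (\<lambda>x. (u x)\<^sup>2 + A\<^sup>2)"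
  proof (intro integral_le)
    show "2 * A * u x \<le> (u x)\<^sup>2 + A\<^sup>2" for x
      using sum_squares_bound[of "u x" A] by (simp add: mult_ac)
  qed (intro integrable_continuous_interval continuous_intros assms)+
  also have "\<dots> = integral {0..1} (\<lambda>x. (u x)\<^sup>2) + A\<^sup>2"
    by (subst integral_add) (use u2 in auto)
  finally have "2 * A * A \<le> integral {0..1} (\<lambda>x. (u x)\<^sup>2) + A\<^sup>2"
    by (simp add: A_def)
  thus ?thesis by (simp add: A_def power2_eq_square)
qed

text \<open>The points of \<open>A\<close> are divided out one at a time. They need not be zeros:
  where \<open>f\<close> does not vanish the order is 0 and the factor is 1.\<close>

lemma zorder_factorization:
  assumes "f holomorphic_on S" "open S" "connected S" "\<exists>w\<in>S. f w \<noteq> 0"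
    and "finite A" "A \<subseteq> S"
  shows "\<exists>g. g holomorphic_on S \<and>
    (\<forall>z\<in>S. f z = (\<Prod>a\<in>A. (z - a) ^ nat (zorder f a)) * g z)"
  using assms(5,6)
proof (induction A rule: finite_induct)
  case empty
  thus ?case using assms(1) by auto
next
  case (insert a A)
  define P where "P = (\<lambda>z. \<Prod>a\<in>A. (z - a) ^ nat (zorder f a))"
  obtain g where g: "g holomorphic_on S" "\<And>z. z \<in> S \<Longrightarrow> f z = P z * g z"
    using insert unfolding P_def by auto
  have nz: "\<exists>w\<in>S. g w \<noteq> 0" using assms(4) g(2) by auto
  have aS: "a \<in> S" using insert by auto
  define m where "m = nat (zorder g a)"
  define h where "h = zor_poly g a"
  obtain r where
    r: "r > 0" "cball a r \<subseteq> S" "h holomorphic_on cball a r"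
    and h: "\<And>w. w \<in> cball a r \<Longrightarrow> g w = h w * (w - a) ^ m \<and> h w \<noteq> 0"
    using zorder_exist_zero[OF g(1) assms(2,3) aS nz] unfolding m_def h_def by blast
  have hb: "h holomorphic_on ball a r" using r(3) holomorphic_on_subset by (metis ball_subset_cball)
  have Ph: "P holomorphic_on T" for T unfolding P_def by (intro holomorphic_intros)
  \<comment> \<open>\<open>P\<close> does not vanish at the new point \<open>a\<close>, so
    \<open>f\<close> and the cofactor \<open>g\<close> have the same order there.\<close>
  have "zorder f a = int m"
  proof (rule zorder_eqI[of "ball a r" a "\<lambda>w. P w * h w"])
    show "P a * h a \<noteq> 0"
      using h[of a] r(1) insert(1,2) by (auto simp: P_def)
    fix w assume "w \<in> ball a r" "w \<noteq> a"
    thus "f w = P w * h w * (w - a) powi int m"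
      using g(2)[of w] h[of w] r(2) by (auto simp: subset_iff)
  qed (use r hb in \<open>auto intro!: holomorphic_intros Ph\<close>)
  hence m: "nat (zorder f a) = m" by simp
  \<comment> \<open>The quotient, with its removable singularity at \<open>a\<close> filled in by
    the local factor \<open>h\<close>.\<close>
  define g2 where "g2 = (\<lambda>w. if w = a then h a else g w / (w - a) ^ m)"
  have g2h: "g2 w = h w" if "w \<in> ball a r" for w
    using h[of w] that by (auto simp: g2_def)
  have "g2 holomorphic_on (S - {a}) \<union> ball a r"
  proof (rule holomorphic_on_Un)
    have "(\<lambda>w. g w / (w - a) ^ m) holomorphic_on (S - {a})"
      using g(1) by (intro holomorphic_intros) (auto intro: holomorphic_on_subset)
    thus "g2 holomorphic_on (S - {a})"
      by (rule holomorphic_transform) (auto simp: g2_def)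
    show "g2 holomorphic_on ball a r"
      using hb by (rule holomorphic_transform) (simp add: g2h)
  qed (use assms(2) in auto)
  moreover have "(S - {a}) \<union> ball a r = S" using r aS by auto
  moreover have "f z = (\<Prod>a\<in>insert a A. (z - a) ^ nat (zorder f a)) * g2 z" if "z \<in> S" for z
  proof -
    have "g z = (z - a) ^ m * g2 z"
      using h[of a] r(1) by (auto simp: g2_def)
    thus ?thesis using g(2)[OF that] insert(1,2) m by (simp add: P_def mult_ac)
  qed
  ultimately show ?case by auto
qed

text \<open>On the circle \<open>R\<^sup>2\<close> equals \<open>cnj u * u\<close>, so the numerator
  is \<open>cnj (u - v) * u\<close>.\<close>

lemma norm_blaschke:
  fixes u v :: complex
  assumes "norm u = R" "R > 0"
  shows "norm ((of_real (R\<^sup>2) - cnj v * u) / of_real R) = norm (u - v)"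
proof -
  have "of_real (R\<^sup>2) = cnj u * u"
    using complex_norm_square[of u] assms by (simp add: mult.commute)
  hence "of_real (R\<^sup>2) - cnj v * u = cnj (u - v) * u" by (simp add: algebra_simps)
  thus ?thesis using assms by (simp add: norm_divide norm_mult del: complex_cnj_diff)
qed

text \<open>
  Replacing each factor \<open>z - a\<close> of \<open>f\<close> by \<open>(R\<^sup>2 - cnj (a - c) (z - c)) / R\<close> does not change the
  modulus on the circle, so the mean value property at \<open>c\<close> applies to the modified function.
\<close>
lemma jensen_zero_count:
  assumes "f holomorphic_on S" "open S" "connected S" "cball c R \<subseteq> S" "0 < r" "r < R"
    and "finite A" "A \<subseteq> cball c r" "f c \<noteq> 0"
  shows "norm (f c) * (R / r) ^ (\<Sum>a\<in>A. nat (zorder f a))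
    \<le> integral {0..1} (\<lambda>x. norm (f (circlepath c R x)))"
proof -
  define m where "m = (\<lambda>a. nat (zorder f a))"
  have R: "R > 0" using assms by simp
  have cS: "c \<in> S" using assms R by auto
  have AS: "A \<subseteq> S" using assms(4,6,8) by (force simp: subset_iff)
  obtain g where g: "g holomorphic_on S" "\<And>z. z \<in> S \<Longrightarrow> f z = (\<Prod>a\<in>A. (z - a) ^ m a) * g z"
    using zorder_factorization[OF assms(1-3) _ assms(7) AS] cS assms(9) unfolding m_def by blast
  define F where
    "F = (\<lambda>z. (\<Prod>a\<in>A. ((of_real (R\<^sup>2) - cnj (a - c) * (z - c)) / of_real R) ^ m a) * g z)"
  have "F holomorphic_on S" unfolding F_def by (intro holomorphic_intros g) (use R in auto)
  from norm_higher_deriv_le_circle_mean[OF this assms(2,4) R, of 0]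
  have "norm (F c) \<le> integral {0..1} (\<lambda>x. norm (F (circlepath c R x)))" by simp
  also have "(\<lambda>x. norm (F (circlepath c R x))) = (\<lambda>x. norm (f (circlepath c R x)))"
  proof
    fix x
    have n: "norm (circlepath c R x - c) = R" using R by (simp add: norm_circlepath_minus)
    have "circlepath c R x \<in> S"
      using assms(4) circlepath_in_cball[of R c x] R by auto
    thus "norm (F (circlepath c R x)) = norm (f (circlepath c R x))"
      using norm_blaschke[OF n R, of "_ - c"]
      by (simp add: F_def g(2) norm_mult norm_power prod_norm [symmetric] del: complex_cnj_diff)
  qed
  finally have 1: "norm (F c) \<le> integral {0..1} (\<lambda>x. norm (f (circlepath c R x)))" .
  \<comment> \<open>At the centre each factor of \<open>F\<close> has the value \<open>R\<close>,
    while \<open>norm (c - a) \<le> r\<close>. Every zero, with multiplicity, thus contributes a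
    gain of \<open>R / r\<close>.\<close>
  have "norm (f c) = (\<Prod>a\<in>A. norm (c - a) ^ m a) * norm (g c)"
    by (simp add: g(2)[OF cS] norm_mult norm_power prod_norm [symmetric])
  also have "\<dots> \<le> (\<Prod>a\<in>A. r ^ m a) * norm (g c)"
    using assms(8) by (intro mult_right_mono prod_mono) (auto simp: dist_norm intro!: power_mono)
  also have "\<dots> = r ^ (\<Sum>a\<in>A. m a) * norm (g c)" by (simp add: power_sum)
  finally have "norm (f c) * (R / r) ^ (\<Sum>a\<in>A. m a)
      \<le> r ^ (\<Sum>a\<in>A. m a) * norm (g c) * (R / r) ^ (\<Sum>a\<in>A. m a)"
    using R assms by (intro mult_right_mono) auto
  also have "\<dots> = R ^ (\<Sum>a\<in>A. m a) * norm (g c)"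
    using assms(5) by (simp add: power_divide)
  also have "\<dots> = norm (F c)"
    using R by (simp add: F_def norm_mult norm_power power2_eq_square norm_divide power_sum prod_norm [symmetric])
  finally show ?thesis using 1 by (simp add: m_def)
qed

section \<open>Means over vertical lines\<close>

lemma circlepath_Complex:
  "circlepath (Complex \<sigma> t) \<rho> x = Complex (\<sigma> + \<rho> * cos (2 * pi * x)) (t + \<rho> * sin (2 * pi * x))"
proof -
  have "exp (2 * of_real pi * \<i> * of_real x) = cis (2 * pi * x)"
    by (simp add: cis_conv_exp mult_ac)
  thus ?thesis by (simp add: circlepath complex_eq_iff)
qed

lemma circle_strip:
  fixes \<rho> :: real
  assumes "\<rho> \<ge> 0" "a \<le> \<sigma> - \<rho>" "\<sigma> + \<rho> \<le> b"
  shows "\<sigma> + \<rho> * cos y \<in> {a..b}" "\<bar>\<rho> * sin y\<bar> \<le> \<rho>"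
proof -
  have "\<bar>\<rho> * cos y\<bar> \<le> \<rho> * 1"
    unfolding abs_mult using assms(1) by (intro mult_mono) auto
  moreover have "\<bar>\<rho> * sin y\<bar> \<le> \<rho> * 1"
    unfolding abs_mult using assms(1) by (intro mult_mono) auto
  ultimately show "\<sigma> + \<rho> * cos y \<in> {a..b}" "\<bar>\<rho> * sin y\<bar> \<le> \<rho>"
    using assms by auto
qed

lemma continuous_on_circle_param:
  fixes F :: "complex \<Rightarrow> real"
  assumes "continuous_on {s. Re s \<in> {a..b}} F" "\<rho> \<ge> 0" "a \<le> \<sigma> - \<rho>" "\<sigma> + \<rho> \<le> b"
  shows "continuous_on A (\<lambda>(t, x). F (circlepath (Complex \<sigma> t) \<rho> x))"
  unfolding circlepath_Complex split_beta
  unfolding Complex_eq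
  by (rule continuous_on_compose2[OF assms(1)])
     (use circle_strip[OF assms(2-4)] in \<open>auto intro!: continuous_intros\<close>)

lemma continuous_on_circle_mean:
  fixes F :: "complex \<Rightarrow> real"
  assumes "continuous_on {s. Re s \<in> {a..b}} F" "\<rho> \<ge> 0" "a \<le> \<sigma> - \<rho>" "\<sigma> + \<rho> \<le> b"
  shows "continuous_on A (\<lambda>t. integral {0..1} (\<lambda>x. F (circlepath (Complex \<sigma> t) \<rho> x)))"
  using integral_continuous_on_param[OF continuous_on_circle_param[OF assms], of A 0 1]
  by simp

lemma continuous_on_vertical:
  fixes F :: "complex \<Rightarrow> 'a :: topological_space"
  assumes "continuous_on {s. Re s \<in> {a..b}} F" "\<sigma> \<in> {a..b}"
  shows "continuous_on A (\<lambda>t. F (Complex \<sigma> t))"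
  unfolding Complex_eq
  by (rule continuous_on_compose2[OF assms(1)]) (use assms(2) in \<open>auto intro!: continuous_intros\<close>)

text \<open>By Fubini: for a fixed angle the circle points run, as \<open>t\<close> varies, along a
  vertical line in the strip, displaced in height by at most \<open>\<rho>\<close>. The bound on
  every vertical line then passes to the circle means.\<close>

lemma vertical_circle_mean_le:
  fixes F :: "complex \<Rightarrow> real"
  assumes cont: "continuous_on {s. Re s \<in> {a..b}} F"
    and nonneg: "\<And>s. Re s \<in> {a..b} \<Longrightarrow> F s \<ge> 0"
    and bound: "\<And>\<sigma> T. \<sigma> \<in> {a..b} \<Longrightarrow> T \<ge> 0 \<Longrightarrow>
      integral {-T..T} (\<lambda>t. F (Complex \<sigma> t)) \<le> C * (T + 1)"
    and \<rho>: "\<rho> \<ge> 0" "a \<le> \<sigma> - \<rho>" "\<sigma> + \<rho> \<le> b" and T: "T \<ge> 0"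
  shows "integral {-T..T} (\<lambda>t. integral {0..1} (\<lambda>x. F (circlepath (Complex \<sigma> t) \<rho> x)))
    \<le> C * (T + \<rho> + 1)"
proof -
  let ?f = "\<lambda>t x. F (circlepath (Complex \<sigma> t) \<rho> x)"
  have c: "continuous_on A (\<lambda>(t, x). ?f t x)" for A
    by (rule continuous_on_circle_param[OF cont \<rho>])
  have c': "continuous_on A (\<lambda>(x, t). ?f t x)" for A
  proof -
    have "continuous_on A (\<lambda>p. (\<lambda>(t, x). ?f t x) (snd p, fst p))"
      by (rule continuous_on_compose2[OF c[of UNIV]]) (auto intro!: continuous_intros)
    thus ?thesis by (simp add: split_beta)
  qed
  have "integral {-T..T} (\<lambda>t. integral {0..1} (?f t)) =
      integral {0..1} (\<lambda>x. integral {-T..T} (\<lambda>t. ?f t x))"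
    using integral_swap_continuous[OF c, where a = "-T" and b = T and c = 0 and d = 1] by simp
  also have "\<dots> \<le> integral {0..1::real} (\<lambda>x. C * (T + \<rho> + 1))"
  proof (rule integral_le)
    show "(\<lambda>x. integral {-T..T} (\<lambda>t. ?f t x)) integrable_on {0..1}"
      using integral_continuous_on_param[OF c', of "{0..1}" "-T" T]
      by (intro integrable_continuous_interval) simp
    fix x :: real
    define \<sigma>' u where "\<sigma>' = \<sigma> + \<rho> * cos (2 * pi * x)" and "u = \<rho> * sin (2 * pi * x)"
    have \<sigma>': "\<sigma>' \<in> {a..b}" and u: "\<bar>u\<bar> \<le> \<rho>"
      using circle_strip[OF \<rho>] by (auto simp: \<sigma>'_def u_def)
    have cv: "continuous_on A (\<lambda>t. F (Complex \<sigma>' t))" for A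
      by (rule continuous_on_vertical[OF cont \<sigma>'])
    have "integral {-T..T} (\<lambda>t. ?f t x) = integral {-T..T} ((\<lambda>t. F (Complex \<sigma>' t)) \<circ> (\<lambda>t. t + u))"
      by (simp add: circlepath_Complex \<sigma>'_def u_def o_def)
    also have "\<dots> = integral {-T + u..T + u} (\<lambda>t. F (Complex \<sigma>' t))"
      by (rule integral_shift[OF cv])
    also have "\<dots> \<le> integral {-(T + \<rho>)..T + \<rho>} (\<lambda>t. F (Complex \<sigma>' t))"
      using u \<sigma>' by (intro integral_subset_le integrable_continuous_interval cv) (auto intro: nonneg)
    also have "\<dots> \<le> C * (T + \<rho> + 1)"
      using T \<rho>(1) by (intro bound \<sigma>') auto
    finally show "integral {-T..T} (\<lambda>t. ?f t x) \<le> C * (T + \<rho> + 1)" .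
  qed auto
  finally show ?thesis by simp
qed

text \<open>Jensen's inequality is applied at every \<open>Complex c t\<close> and integrated over
  \<open>t\<close>. By the Pythagorean condition on \<open>\<eta>\<close>, a point \<open>a\<close>
  of \<open>A\<close> lies in the inner disc whenever \<open>t\<close> is within
  \<open>\<eta>\<close> of \<open>Im a\<close>, so it is counted on a window of length
  \<open>2 * \<eta>\<close>.\<close>

lemma zero_count_le_vertical_mean:
  assumes f: "f holomorphic_on {s. Re s > \<alpha>}" and \<alpha>: "\<alpha> < c - R"
    and r: "0 < r" "r < R" and \<eta>: "\<eta> > 0" "(c - \<sigma>)\<^sup>2 + \<eta>\<^sup>2 \<le> r\<^sup>2"
    and \<kappa>: "\<kappa> > 0" "\<And>t. \<kappa> \<le> norm (f (Complex c t))"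
    and bound: "\<And>\<sigma> T. \<sigma> \<in> {c - R..c + R} \<Longrightarrow> T \<ge> 0 \<Longrightarrow>
      integral {-T..T} (\<lambda>t. norm (f (Complex \<sigma> t))) \<le> C * (T + 1)"
    and A: "finite A" "\<And>a. a \<in> A \<Longrightarrow> \<sigma> \<le> Re a \<and> Re a \<le> c \<and> \<bar>Im a\<bar> \<le> T" and T: "T \<ge> 0"
  shows "2 * \<eta> * ln (R / r) * real (\<Sum>a\<in>A. nat (zorder f a)) \<le> C / \<kappa> * (T + \<eta> + R + 1)"
proof -
  let ?S = "{s. Re s > \<alpha>}"
  define m where "m = (\<lambda>a. nat (zorder f a))"
  define I where "I = (\<lambda>t. integral {0..1} (\<lambda>x. norm (f (circlepath (Complex c t) R x))))"
  have R: "R > 0" using r by simp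
  have sub: "{s. Re s \<in> {c - R..c + R}} \<subseteq> ?S" using \<alpha> by auto
  have cont: "continuous_on {s. Re s \<in> {c - R..c + R}} (\<lambda>s. norm (f s))"
    using f sub
    by (intro continuous_on_norm holomorphic_on_imp_continuous_on) (rule holomorphic_on_subset)
  have contI: "continuous_on B I" for B
    unfolding I_def by (rule continuous_on_circle_mean[OF cont]) (use R in auto)
  have loc: "(\<Sum>a\<in>A. ln (R / r) * real (m a) * indicat_real {Im a - \<eta>..Im a + \<eta>} t) \<le> I t / \<kappa>" for t
  proof -
    define A' where "A' = {a\<in>A. t \<in> {Im a - \<eta>..Im a + \<eta>}}"
    have fin: "finite A'" using A(1) by (simp add: A'_def)
    have "A' \<subseteq> cball (Complex c t) r"
    proof
      fix a assume "a \<in> A'"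
      hence a: "\<sigma> \<le> Re a" "Re a \<le> c" "\<bar>t - Im a\<bar> \<le> \<eta>" using A(2) by (auto simp: A'_def)
      have "(c - Re a)\<^sup>2 \<le> (c - \<sigma>)\<^sup>2" using a by (intro power_mono) auto
      moreover have "(t - Im a)\<^sup>2 \<le> \<eta>\<^sup>2" using a \<eta> by (metis power2_abs power_mono abs_ge_zero)
      ultimately have "sqrt ((c - Re a)\<^sup>2 + (t - Im a)\<^sup>2) \<le> r"
        using \<eta>(2) r(1) by (intro real_le_lsqrt) auto
      thus "a \<in> cball (Complex c t) r" by (simp add: dist_norm cmod_def)
    qed
    moreover have "cball (Complex c t) R \<subseteq> ?S"
    proof
      fix z assume "z \<in> cball (Complex c t) R"
      thus "z \<in> ?S"
        using \<alpha> abs_Re_le_cmod[of "Complex c t - z"] by (auto simp: dist_norm)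
    qed
    ultimately have "norm (f (Complex c t)) * (R / r) ^ (\<Sum>a\<in>A'. m a) \<le> I t"
      unfolding m_def I_def using \<kappa>(1) \<kappa>(2)[of t] r fin
      by (intro jensen_zero_count[OF f open_halfspace_Re_gt])
         (auto simp: convex_connected convex_halfspace_Re_gt)
    moreover have "\<kappa> * (R / r) ^ (\<Sum>a\<in>A'. m a)
        \<le> norm (f (Complex c t)) * (R / r) ^ (\<Sum>a\<in>A'. m a)"
      using \<kappa> r by (intro mult_right_mono) auto
    ultimately have 1: "(R / r) ^ (\<Sum>a\<in>A'. m a) \<le> I t / \<kappa>"
      using \<kappa>(1) by (simp add: field_simps)
    have "(\<Sum>a\<in>A. ln (R / r) * real (m a) * indicat_real {Im a - \<eta>..Im a + \<eta>} t)
        = (\<Sum>a\<in>A'. ln (R / r) * real (m a))"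
      using A(1) by (intro sum.mono_neutral_cong_right) (auto simp: A'_def)
    also have "\<dots> = ln ((R / r) ^ (\<Sum>a\<in>A'. m a))"
      using r by (simp add: ln_realpow sum_distrib_left mult_ac)
    \<comment> \<open>Giving up the logarithm here is wasteful but makes a linear bound on the mean
      of \<open>norm (f s)\<close> sufficient.\<close>
    also have "\<dots> \<le> (R / r) ^ (\<Sum>a\<in>A'. m a)"
      using r by (intro order.trans[OF ln_le_minus_one]) auto
    finally show ?thesis using 1 by linarith
  qed
  \<comment> \<open>Enlarging the range of \<open>t\<close> by \<open>\<eta>\<close> keeps each
    whole window inside it.\<close>
  have ind: "((\<lambda>t. indicat_real {Im a - \<eta>..Im a + \<eta>} t) has_integral (2 * \<eta>)) {-(T + \<eta>)..T + \<eta>}"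
    if "a \<in> A" for a
  proof -
    have "((\<lambda>t. 1 :: real) has_integral (2 * \<eta>)) {Im a - \<eta>..Im a + \<eta>}"
      using has_integral_const_real[of "1::real" "Im a - \<eta>" "Im a + \<eta>"] \<eta>(1) by simp
    hence "((\<lambda>t. if t \<in> {Im a - \<eta>..Im a + \<eta>} then 1 else 0 :: real) has_integral (2 * \<eta>))
        {-(T + \<eta>)..T + \<eta>}"
      using A(2)[OF that] by (subst has_integral_restrict) auto
    thus ?thesis by (simp add: indicator_def of_bool_def)
  qed
  have sumint: "((\<lambda>t. \<Sum>a\<in>A. ln (R / r) * real (m a) * indicat_real {Im a - \<eta>..Im a + \<eta>} t)
      has_integral (\<Sum>a\<in>A. ln (R / r) * real (m a) * (2 * \<eta>))) {-(T + \<eta>)..T + \<eta>}"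
    by (intro has_integral_sum has_integral_mult_right ind A(1))
  have "(\<Sum>a\<in>A. ln (R / r) * real (m a) * (2 * \<eta>)) \<le> integral {-(T + \<eta>)..T + \<eta>} (\<lambda>t. I t / \<kappa>)"
    by (rule has_integral_le[OF sumint integrable_integral])
       (use \<kappa>(1) loc in \<open>auto intro!: integrable_continuous_interval continuous_intros contI\<close>)
  also have "\<dots> = integral {-(T + \<eta>)..T + \<eta>} I / \<kappa>" by simp
  also have "\<dots> \<le> C * (T + \<eta> + R + 1) / \<kappa>"
    unfolding I_def using R \<kappa>(1) T \<eta>(1)
    by (intro divide_right_mono vertical_circle_mean_le[OF cont _ bound]) auto
  finally show ?thesis by (simp add: m_def sum_distrib_left mult_ac)
qed

section \<open>The mean square of a Dirichlet polynomial\<close>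

lemma cube_powr_third: "x \<ge> 0 \<Longrightarrow> (x powr (1/3)) ^ 3 = (x::real)"
  by (cases "x = 0") (auto simp: powr_powr simp flip: powr_realpow)

lemma powr_neg_twothirds: "x > 0 \<Longrightarrow> x powr (-(2/3)) = 1 / (x powr (1/3)) ^ 2"
  for x :: real
  by (simp add: powr_powr powr_minus field_simps flip: powr_realpow)

lemma powr_neg_fivethirds: "x > 0 \<Longrightarrow> x powr (-(5/3)) = 1 / (x powr (1/3)) ^ 5"
  for x :: real
  by (simp add: powr_powr powr_minus field_simps flip: powr_realpow)

text \<open>A discrete form of the integral of \<open>x powr (-(2/3))\<close>: for the cube roots,
  \<open>u ^ 3 - v ^ 3 = 1\<close>, and after splitting off \<open>u - v\<close> the quadratic
  factor is at most \<open>3 * u\<^sup>2\<close>.\<close>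

lemma powr_twothirds_step:
  fixes x :: real
  assumes "x \<ge> 0"
  shows "(x + 1) powr (-(2/3)) \<le> 3 * ((x + 1) powr (1/3) - x powr (1/3))"
proof -
  define u v where "u = (x + 1) powr (1/3)" and "v = x powr (1/3)"
  have uv: "0 \<le> v" "v \<le> u" "u > 0"
    using assms by (auto simp: u_def v_def intro: powr_mono2)
  have "1 = u ^ 3 - v ^ 3" using assms by (simp add: u_def v_def cube_powr_third)
  also have "\<dots> = (u - v) * (u\<^sup>2 + u * v + v\<^sup>2)" by algebra
  also have "\<dots> \<le> (u - v) * (3 * u\<^sup>2)"
  proof (intro mult_left_mono)
    have "u * v \<le> u * u" "v * v \<le> u * u" using uv by (auto intro!: mult_mono)
    thus "u\<^sup>2 + u * v + v\<^sup>2 \<le> 3 * u\<^sup>2" by (simp add: power2_eq_square)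
  qed (use uv in auto)
  finally have "1 / u\<^sup>2 \<le> 3 * (u - v)" using uv by (simp add: field_simps)
  thus ?thesis using assms powr_neg_twothirds[of "x + 1"] by (simp add: u_def v_def)
qed

text \<open>The preceding bound, multiplied by one for \<open>1 / u ^ 3\<close>, becomes a
  difference of inverse squares. The constant 3 is twice that of the integral, which only affects
  later constants.\<close>

lemma powr_fivethirds_step:
  fixes x :: real
  assumes "x > 0"
  shows "(x + 1) powr (-(5/3)) \<le> 3 * (x powr (-(2/3)) - (x + 1) powr (-(2/3)))"
proof -
  define u v where "u = (x + 1) powr (1/3)" and "v = x powr (1/3)"
  have uv: "0 < v" "v \<le> u" "u > 0"
    using assms by (auto simp: u_def v_def intro: powr_mono2)
  have "1 / u\<^sup>2 \<le> 3 * (u - v)"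
    using powr_twothirds_step[of x] powr_neg_twothirds[of "x + 1"] assms
    by (simp add: u_def v_def)
  moreover have "1 / u ^ 3 \<le> (u + v) / (u\<^sup>2 * v\<^sup>2)"
  proof -
    have "u\<^sup>2 * v\<^sup>2 \<le> u\<^sup>2 * (u * v + u * u)"
      using uv mult_mono[of v u v u] by (intro mult_left_mono) (auto simp: power2_eq_square intro: add_increasing)
    also have "\<dots> = (u + v) * u ^ 3" by algebra
    finally show ?thesis using uv by (simp add: field_simps)
  qed
  ultimately have "1 / u\<^sup>2 * (1 / u ^ 3) \<le> 3 * (u - v) * ((u + v) / (u\<^sup>2 * v\<^sup>2))"
    using uv by (intro mult_mono) auto
  also have "\<dots> = 3 * (1 / v\<^sup>2 - 1 / u\<^sup>2)"
    using uv by (simp add: field_simps power2_eq_square)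
  finally have "1 / u ^ 5 \<le> 3 * (1 / v\<^sup>2 - 1 / u\<^sup>2)"
    by (simp flip: power_add)
  thus ?thesis
    using assms powr_neg_twothirds[of "x + 1"] powr_neg_twothirds[of x] powr_neg_fivethirds[of "x + 1"]
    by (simp add: u_def v_def)
qed

lemma sum_powr_twothirds_le: "(\<Sum>n=1..N. real n powr (-(2/3))) \<le> 3 * real N powr (1/3)"
proof (induction N)
  case (Suc N)
  thus ?case using powr_twothirds_step[of "real N"] by (simp add: add.commute)
qed simp

lemma sum_powr_fivethirds_le: "(\<Sum>n=1..N. real n powr (-(5/3))) \<le> 4"
proof -
  \<comment> \<open>The subtracted term makes the induction telescope. At \<open>N = 0\<close> both
    sides are 1, which is where \<open>4 = 1 + 3\<close> comes from.\<close>
  have "(\<Sum>n=1..Suc N. real n powr (-(5/3))) \<le> 4 - 3 * real (Suc N) powr (-(2/3))" for N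
  proof (induction N)
    case (Suc N)
    thus ?case using powr_fivethirds_step[of "real (Suc N)"] by (simp add: add.commute)
  qed simp
  from this[of "N - 1"] show ?thesis
    by (cases N) (auto intro: order.trans)
qed

lemma suminf_powr_fivethirds:
  assumes "N \<ge> 1"
  shows "summable (\<lambda>n. real (Suc (n + N)) powr (-(5/3)))"
    and "(\<Sum>n. real (Suc (n + N)) powr (-(5/3))) \<le> 3 * real N powr (-(2/3))"
proof -
  let ?g = "\<lambda>n. real (n + N) powr (-(2/3))"
  have "?g \<longlonglongrightarrow> 0"
    by (rule tendsto_neg_powr)
       (auto intro!: filterlim_compose[OF filterlim_real_sequentially filterlim_add_const_nat_at_top]
          simp del: of_nat_add)
  from sums_mult[OF telescope_sums'[OF this], of 3]
  have t: "(\<lambda>n. 3 * (?g n - ?g (Suc n))) sums (3 * real N powr (-(2/3)))" by simp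
  have le: "real (Suc (n + N)) powr (-(5/3)) \<le> 3 * (?g n - ?g (Suc n))" for n
    using powr_fivethirds_step[of "real (n + N)"] assms by (simp add: add_ac)
  show s: "summable (\<lambda>n. real (Suc (n + N)) powr (-(5/3)))"
    by (rule summable_comparison_test'[OF sums_summable[OF t]]) (use le in simp)
  show "(\<Sum>n. real (Suc (n + N)) powr (-(5/3))) \<le> 3 * real N powr (-(2/3))"
    using suminf_le[OF le s sums_summable[OF t]] sums_unique[OF t] by simp
qed

text \<open>Here the exponent 5/6 enters. With \<open>d = n - m\<close> one has
  \<open>ln n - ln m \<ge> d / n\<close>, and partial fractions give
  \<open>1 / (m * d) = (1 / n) * (1 / m + 1 / d)\<close>. Two factors of size at most
  \<open>n powr (1/6)\<close> against \<open>1 / n\<close> leave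
  \<open>n powr (-(2/3))\<close>.\<close>

lemma ln_diff_pair_bound:
  fixes m n :: nat
  assumes "1 \<le> m" "m < n" "\<sigma> \<ge> 5/6"
  shows "real m powr (-\<sigma>) * real n powr (-\<sigma>) / (ln n - ln m)
    \<le> real n powr (-(2/3)) * (real m powr (-(2/3)) + real (n - m) powr (-(2/3)))"
proof -
  define x y d where "x = real m" and "y = real n" and "d = real (n - m)"
  have x: "x \<ge> 1" "x < y" "d = y - x" "d \<ge> 1" using assms by (auto simp: x_def y_def d_def of_nat_diff)
  have "ln (x / y) \<le> x / y - 1" using x by (intro ln_le_minus_one) auto
  hence l: "d / y \<le> ln y - ln x" using x by (simp add: ln_div field_simps)
  have "x powr (-\<sigma>) * y powr (-\<sigma>) / (ln y - ln x) \<le> x powr (-(5/6)) * y powr (-(5/6)) / (d / y)"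
    using x l assms(3) by (intro frac_le mult_mono) (auto intro!: powr_mono)
  also have "\<dots> = x powr (1/6) * y powr (1/6) * (1 / (x * d))"
  proof -
    have "z powr (-(5/6)) = z powr (1/6) / z" if "z > 0" for z :: real
      using that powr_diff[of z "1/6" 1] by simp
    thus ?thesis using x by (simp del: powr_minus)
  qed
  also have "1 / (x * d) = (1 / y) * (1 / x + 1 / d)"
    using x by (simp add: field_simps)
  also have "x powr (1/6) * y powr (1/6) * (1 / y * (1 / x + 1 / d))
      \<le> y powr (1/6) * y powr (1/6) * (1 / y * (x powr (-(2/3)) + d powr (-(2/3))))"
  proof -
    \<comment> \<open>This loss gives all factors the same exponent, so that the double sums later
      reduce to the square of a single sum.\<close>
    have "1 / z \<le> z powr (-(2/3))" if "z \<ge> 1" for z :: real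
      using powr_mono[of "-1" "-(2/3)" z] that by (simp add: powr_minus_divide)
    thus ?thesis using x
      by (intro mult_mono add_mono) (auto intro!: powr_mono2 mult_nonneg_nonneg add_nonneg_nonneg)
  qed
  also have "\<dots> = (y powr (1/6) * y powr (1/6) * (1 / y)) * (x powr (-(2/3)) + d powr (-(2/3)))"
    by simp
  also have "y powr (1/6) * y powr (1/6) * (1 / y) = y powr (-(2/3))"
  proof -
    have "y powr (1/6 + 1/6 - 1) = y powr (1/6) * y powr (1/6) * (1 / y)"
      using x by (simp only: powr_add powr_diff) simp
    thus ?thesis by simp
  qed
  finally show ?thesis by (simp add: x_def y_def d_def)
qed

section \<open>Diagonal and off-diagonal terms of the mean square\<close>

lemma norm_sum_zpow_squared:
  "(norm (\<Sum>n=1..N. zpow (real n) (Complex \<sigma> t)))\<^sup>2 =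
   (\<Sum>m=1..N. \<Sum>n=1..N. real m powr (-\<sigma>) * real n powr (-\<sigma>) * cos ((ln m - ln n) * t))"
proof -
  have z: "(\<Sum>n=1..N. zpow (real n) (Complex \<sigma> t)) =
      (\<Sum>n=1..N. Complex (real n powr (-\<sigma>) * cos (t * ln n)) (- (real n powr (-\<sigma>) * sin (t * ln n))))"
    by (intro sum.cong) (auto simp: zpow_def complex_eq_iff Re_exp Im_exp powr_def)
  have "(norm (\<Sum>n=1..N. zpow (real n) (Complex \<sigma> t)))\<^sup>2 =
      (\<Sum>n=1..N. real n powr (-\<sigma>) * cos (t * ln n))\<^sup>2 + (\<Sum>n=1..N. real n powr (-\<sigma>) * sin (t * ln n))\<^sup>2"
    unfolding z by (simp add: cmod_power2 sum_negf)
  also have "\<dots> = (\<Sum>m=1..N. \<Sum>n=1..N. real m powr (-\<sigma>) * real n powr (-\<sigma>) * cos ((ln m - ln n) * t))"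
    by (simp add: power2_eq_square sum_product cos_diff algebra_simps flip: sum.distrib)
  finally show ?thesis .
qed

lemma integral_cos_symmetric:
  fixes l :: real
  assumes "T \<ge> 0"
  shows "integral {-T..T} (\<lambda>t. cos (l * t)) = (if l = 0 then 2 * T else 2 * sin (l * T) / l)"
proof (cases "l = 0")
  case False
  have "((\<lambda>t. cos (l * t)) has_integral (sin (l * T) / l - sin (l * (-T)) / l)) {-T..T}"
    using assms False
    by (intro fundamental_theorem_of_calculus)
       (auto intro!: derivative_eq_intros simp flip: has_real_derivative_iff_has_vector_derivative)
  thus ?thesis using False by (simp add: integral_unique)
qed (use assms in auto)

text \<open>The diagonal contributes \<open>2 * T\<close> times a sum bounded by 4. Off the
  diagonal, integrating the cosine gives at most \<open>2 / \<bar>ln n - ln m\<bar>\<close>, hence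
  double sums bounded by \<open>S * S\<close>.\<close>

lemma dirichlet_polynomial_mean_square:
  assumes "\<sigma> \<ge> 5/6" "T \<ge> 0"
  shows "integral {-T..T} (\<lambda>t. (norm (\<Sum>n=1..N. zpow (real n) (Complex \<sigma> t)))\<^sup>2)
    \<le> 8 * T + 54 * (real N powr (1/3))\<^sup>2"
proof -
  define a p where "a = (\<lambda>n::nat. real n powr (-\<sigma>))" and "p = (\<lambda>n::nat. real n powr (-(2/3)))"
  define S where "S = (\<Sum>n=1..N. p n)"
  define J where "J = (\<lambda>m n. integral {-T..T} (\<lambda>t. cos ((ln (real m) - ln (real n)) * t)))"
  have p0: "p n \<ge> 0" for n by (simp add: p_def)
  have S0: "S \<ge> 0" by (simp add: S_def p0 sum_nonneg)
  have S: "S \<le> 3 * real N powr (1/3)" unfolding S_def p_def by (rule sum_powr_twothirds_le)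
  have asymm: "a m * a n * J m n \<le> 2 * (p n * p m + p n * p (n - m))"
    if "1 \<le> m" "m < n" for m n
  proof -
    have l: "ln (real m) < ln (real n)" using that by simp
    have "J m n \<le> \<bar>J m n\<bar>" by simp
    also have "\<dots> = 2 * \<bar>sin ((ln m - ln n) * T)\<bar> / (ln n - ln m)"
      using l by (simp add: J_def integral_cos_symmetric[OF assms(2)] abs_mult)
    also have "\<dots> \<le> 2 / (ln n - ln m)"
      using l by (intro divide_right_mono) auto
    finally have "a m * a n * J m n \<le> a m * a n * (2 / (ln n - ln m))"
      by (intro mult_left_mono) (auto simp: a_def)
    also have "\<dots> \<le> 2 * (p n * (p m + p (n - m)))"
      using mult_left_mono[OF ln_diff_pair_bound[OF that assms(1)], of 2]
      by (simp add: a_def p_def mult_ac)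
    finally show ?thesis by (simp add: algebra_simps)
  qed
  have Jsym: "J m n = J n m" for m n
  proof -
    have "cos ((ln (real m) - ln (real n)) * t) = cos ((ln (real n) - ln (real m)) * t)" for t
      using cos_minus[of "(ln (real m) - ln (real n)) * t"] by (simp add: algebra_simps)
    thus ?thesis by (simp add: J_def)
  qed
  \<comment> \<open>One bound serves all three orderings: a truncated difference of the wrong sign
    is 0, and \<open>p 0 = 0\<close> because 0 to any real power is 0 here.\<close>
  have pair: "a m * a n * J m n \<le>
      (if m = n then 2 * T * real n powr (-(5/3)) else 0) + 2 * (p n * p m + p n * p (n - m) + p m * p (m - n))"
    if "m \<in> {1..N}" "n \<in> {1..N}" for m n
  proof (cases m n rule: linorder_cases)
    case equal
    have "a n * a n = real n powr (-(2 * \<sigma>))" using that by (simp add: a_def flip: powr_add)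
    also have "\<dots> \<le> real n powr (-(5/3))" using that assms(1) by (intro powr_mono) auto
    finally have "2 * T * (a n * a n) \<le> 2 * T * real n powr (-(5/3))"
      using assms(2) by (intro mult_left_mono) auto
    moreover have "J n n = 2 * T" by (simp add: J_def integral_cos_symmetric[OF assms(2)])
    moreover have "0 \<le> 2 * (p n * p n + p n * p (n - n) + p n * p (n - n))" using p0 by simp
    ultimately have "a n * a n * J n n \<le>
        2 * T * real n powr (-(5/3)) + 2 * (p n * p n + p n * p (n - n) + p n * p (n - n))"
      by (intro add_increasing2) (simp_all only: mult.commute)
    thus ?thesis using equal by simp
  next
    case less
    have "0 \<le> p m * p (m - n)" using p0 by simp
    thus ?thesis using asymm[of m n] that less by simp
  next
    case greater
    have "0 \<le> p n * p (n - m)" using p0 by simp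
    thus ?thesis using asymm[of n m] that greater Jsym[of n m] by (simp add: mult_ac)
  qed
  \<comment> \<open>The terms with \<open>m \<ge> n\<close> vanish; the others are distinct terms of
    \<open>S\<close>, indexed by the gap \<open>n - m\<close>.\<close>
  have shift: "(\<Sum>m=1..N. p (n - m)) \<le> S" if "n \<le> N" for n
  proof -
    have "(\<Sum>m=1..N. p (n - m)) = (\<Sum>m\<in>{m\<in>{1..N}. m < n}. p (n - m))"
      by (intro sum.mono_neutral_right) (auto simp: p_def)
    also have "\<dots> \<le> S"
      unfolding S_def
      by (rule sum_le_included[where i = "\<lambda>y. n - y"]) (use that p0 in \<open>auto intro!: bexI[of _ "n - _"]\<close>)
    finally show ?thesis .
  qed
  have dbl: "(\<Sum>n=1..N. \<Sum>m=1..N. p n * p (n - m)) \<le> S * S"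
  proof -
    have "(\<Sum>n=1..N. \<Sum>m=1..N. p n * p (n - m)) \<le> (\<Sum>n=1..N. p n * S)"
      using shift p0 by (intro sum_mono) (auto simp: sum_distrib_left [symmetric] intro!: mult_left_mono)
    thus ?thesis by (simp add: S_def sum_distrib_right)
  qed
  have "integral {-T..T} (\<lambda>t. (norm (\<Sum>n=1..N. zpow (real n) (Complex \<sigma> t)))\<^sup>2)
      = (\<Sum>m=1..N. \<Sum>n=1..N. a m * a n * J m n)"
    unfolding norm_sum_zpow_squared a_def J_def
    by (intro integral_unique has_integral_sum has_integral_mult_right integrable_integral
        integrable_continuous_interval continuous_intros) auto
  also have "\<dots> \<le> (\<Sum>m=1..N. \<Sum>n=1..N. (if m = n then 2 * T * real n powr (-(5/3)) else 0) +
      2 * (p n * p m + p n * p (n - m) + p m * p (m - n)))"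
    by (intro sum_mono pair)
  also have "\<dots> = 2 * T * (\<Sum>n=1..N. real n powr (-(5/3))) +
      2 * (S * S + (\<Sum>m=1..N. \<Sum>n=1..N. p n * p (n - m)) + (\<Sum>n=1..N. \<Sum>m=1..N. p n * p (n - m)))"
    by (simp add: sum.distrib sum_distrib_left sum_product S_def mult_ac distrib_left)
  also have "(\<Sum>m=1..N. \<Sum>n=1..N. p n * p (n - m)) = (\<Sum>n=1..N. \<Sum>m=1..N. p n * p (n - m))"
    by (rule sum.swap)
  also have "2 * T * (\<Sum>n=1..N. real n powr (-(5/3))) + 2 * (S * S + \<dots> + \<dots>) \<le> 2 * T * 4 + 2 * (S * S + S * S + S * S)"
    using sum_powr_fivethirds_le[of N] assms(2) dbl S0 by (intro add_mono mult_left_mono) auto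
  \<comment> \<open>Three copies of \<open>S * S\<close>, each at most 9 times the squared cube root
    of \<open>N\<close>, with the factor 2, give the constant 54.\<close>
  also have "\<dots> \<le> 8 * T + 6 * (3 * real N powr (1/3) * (3 * real N powr (1/3)))"
    using mult_mono[OF S S] S0 by simp
  finally show ?thesis by (simp add: power2_eq_square)
qed

section \<open>The mean square of the zeta function\<close>

lemma holomorphic_zeta: "zeta holomorphic_on - {1}"
  using is_zeta_continuation_zeta by (auto simp: is_zeta_continuation_def)

lemma zeta_eq_zeta_right:
  assumes "Re s > 0" "s \<noteq> 1"
  shows "zeta s = zeta_right s"
proof -
  let ?S = "{s::complex. Re s > 0} - {1}"
  have sums: "\<And>z. Re z > 1 \<Longrightarrow> (\<lambda>n. of_nat (Suc n) powr (- z)) sums zeta z"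
    using is_zeta_continuation_zeta by (auto simp: is_zeta_continuation_def)
  have "zeta s - zeta_right s = 0"
  proof (rule analytic_continuation[where f = "\<lambda>s. zeta s - zeta_right s" and S = ?S
        and U = "{z. Re z > 1}" and \<xi> = 2])
    show "(\<lambda>s. zeta s - zeta_right s) holomorphic_on ?S"
      by (intro holomorphic_intros zeta_right_holomorphic holomorphic_on_subset[OF holomorphic_zeta]) auto
    show "open ?S" by (intro open_Diff open_halfspace_Re_gt) auto
    show "connected ?S"
      by (intro connected_open_delete open_halfspace_Re_gt convex_connected convex_halfspace_Re_gt)
         simp
    show "(2::complex) islimpt {z. Re z > 1}"
      by (rule interior_limit_point) (simp add: interior_open open_halfspace_Re_gt)
    fix z :: complex assume "z \<in> {z. Re z > 1}"
    hence z: "Re z > 1" by simp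
    have "(\<lambda>n. of_nat (Suc n) powr (- z)) sums zeta_right z"
      using zeta_right_eq[OF z] zpow_of_nat[of "Suc _" z] by simp
    thus "zeta z - zeta_right z = 0" using sums_unique2[OF sums[OF z]] by simp
  qed (use assms in auto)
  thus ?thesis by simp
qed

text \<open>In the first \<open>N\<close> terms of the series behind \<open>zeta_right\<close> the
  integral parts telescope to a boundary term, leaving the partial sum.\<close>

lemma zeta_approximation:
  assumes "Re s > 0" "s \<noteq> 1"
  shows "zeta s = (\<Sum>n=1..N. zpow (real n) s) + zpow (real (Suc N)) (s - 1) / (s - 1)
    + (\<Sum>n. zterm (n + N) s)"
proof -
  have "(\<Sum>n<N. zterm n s) = (\<Sum>n<N. zpow (real (Suc n)) s) -
      (\<Sum>n<N. zpow (real (Suc n)) (s - 1) - zpow (real (Suc (Suc n))) (s - 1)) / (s - 1)"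
    by (simp add: zterm_def sum_subtractf add_ac flip: sum_divide_distrib)
  also have "(\<Sum>n<N. zpow (real (Suc n)) (s - 1) - zpow (real (Suc (Suc n))) (s - 1))
      = zpow 1 (s - 1) - zpow (real (Suc N)) (s - 1)"
    using sum_lessThan_telescope'[of "\<lambda>n. zpow (real (Suc n)) (s - 1)" N] by simp
  also have "zpow 1 (s - 1) = 1" by (simp add: zpow_def)
  also have "(\<Sum>n<N. zpow (real (Suc n)) s) = (\<Sum>n=1..N. zpow (real n) s)"
    by (rule sum.reindex_bij_witness[of _ "\<lambda>n. n - 1" Suc]) auto
  finally have "(\<Sum>n. zterm n s) = (\<Sum>n. zterm (n + N) s) + ((\<Sum>n=1..N. zpow (real n) s)
      - (1 - zpow (real (Suc N)) (s - 1)) / (s - 1))"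
    using suminf_split_initial_segment[OF zterm_summable[OF assms], of N] by simp
  thus ?thesis
    using zeta_eq_zeta_right[OF assms] by (simp add: zeta_right_def diff_divide_distrib)
qed

text \<open>Termwise comparison with the exponent -5/3, available from \<open>Re s \<ge> 2/3\<close>
  on. For \<open>N = k ^ 3\<close> and \<open>norm s\<close> of order \<open>k ^ 2\<close> the bound
  becomes a constant, which explains these choices later.\<close>

lemma norm_zterm_tail_le:
  assumes "Re s \<ge> 2/3" "s \<noteq> 1" "N \<ge> 1"
  shows "norm (\<Sum>n. zterm (n + N) s) \<le> 3 * norm s * real N powr (-(2/3))"
proof -
  have bd: "norm (zterm (n + N) s) \<le> norm s * real (Suc (n + N)) powr (-(5/3))" for n
  proof (rule order.trans[OF zterm_bound])
    have "real (Suc (n + N)) powr (- (Re s + 1)) \<le> real (Suc (n + N)) powr (-(5/3))"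
      using assms(1) by (intro powr_mono) auto
    thus "norm s * real (Suc (n + N)) powr (- (Re s + 1)) \<le> norm s * real (Suc (n + N)) powr (-(5/3))"
      by (rule mult_left_mono) simp
  qed (use assms in auto)
  note S = suminf_powr_fivethirds[OF assms(3)]
  have "norm (\<Sum>n. zterm (n + N) s) \<le> (\<Sum>n. norm s * real (Suc (n + N)) powr (-(5/3)))"
    by (rule norm_suminf_le[OF bd]) (intro summable_mult S)
  also have "\<dots> = norm s * (\<Sum>n. real (Suc (n + N)) powr (-(5/3)))"
    by (rule suminf_mult[OF S(1)])
  also have "\<dots> \<le> norm s * (3 * real N powr (-(2/3)))"
    by (intro mult_left_mono S) auto
  finally show ?thesis by (simp add: mult_ac)
qed

text \<open>
  The Moebius factor cancels the pole of \<open>zeta\<close> at 1 while staying bounded by 1 on the right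
  half-plane, so that no neighbourhood of the pole has to be treated separately.
\<close>
definition zeta_reg :: "complex \<Rightarrow> complex" where
  "zeta_reg s = (if s = 1 then 1/2 else (s - 1) / (s + 1) * zeta s)"

lemma Re_pos_neq: "Re s > 0 \<Longrightarrow> s + 1 \<noteq> 0"
  by (auto simp: complex_eq_iff)

lemma zeta_reg_approximation:
  assumes "Re s > 0" "s \<noteq> 1"
  shows "zeta_reg s = (s - 1) / (s + 1) * (\<Sum>n=1..N. zpow (real n) s)
    + zpow (real (Suc N)) (s - 1) / (s + 1) + (s - 1) / (s + 1) * (\<Sum>n. zterm (n + N) s)"
proof -
  have "(s - 1) / (s + 1) * (v / (s - 1)) = v / (s + 1)" for v
    using assms(2) by simp
  thus ?thesis
    using assms(2) by (simp only: zeta_reg_def zeta_approximation[OF assms, of N] distrib_left if_False)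
qed

text \<open>The singularity at 1 is removable: in the approximation with \<open>N = 1\<close> the
  three summands tend to 0, 1/2 and 0, which also explains the value 1/2 in
  \<open>zeta_reg\<close>.\<close>

lemma holomorphic_zeta_reg: "zeta_reg holomorphic_on {s. Re s > 0}"
proof (rule no_isolated_singularity)
  have "(\<lambda>s. (s - 1) / (s + 1) * zeta s) holomorphic_on ({s. Re s > 0} - {1})"
    using Re_pos_neq by (intro holomorphic_intros holomorphic_on_subset[OF holomorphic_zeta]) auto
  thus hol: "zeta_reg holomorphic_on ({s. Re s > 0} - {1})"
    by (rule holomorphic_transform) (auto simp: zeta_reg_def)
  have near: "eventually (\<lambda>s. s \<in> {s. Re s > 2/3} - {1}) (at (1::complex))"
    by (intro eventually_at_in_open open_halfspace_Re_gt) simp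
  \<comment> \<open>The series stays bounded near 1, so the factor \<open>s - 1\<close> forces the
    limit 0.\<close>
  have t: "((\<lambda>s. (s - 1) / (s + 1) * (\<Sum>n. zterm (n + 1) s)) \<longlongrightarrow> 0) (at 1)"
  proof (rule Lim_null_comparison)
    have "((\<lambda>s::complex. norm ((s - 1) / (s + 1)) * (3 * norm s)) \<longlongrightarrow> norm ((1 - 1) / (1 + 1 :: complex)) * (3 * norm (1 :: complex))) (at 1)"
      by (intro tendsto_intros) auto
    thus "((\<lambda>s::complex. norm ((s - 1) / (s + 1)) * (3 * norm s)) \<longlongrightarrow> 0) (at 1)" by simp
    show "\<forall>\<^sub>F s in at 1. norm ((s - 1) / (s + 1) * (\<Sum>n. zterm (n + 1) s)) \<le> norm ((s - 1) / (s + 1)) * (3 * norm s)"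
      using near
    proof eventually_elim
      case (elim s)
      thus ?case using norm_zterm_tail_le[of s 1] unfolding norm_mult
        by (intro mult_left_mono) auto
    qed
  qed
  have "((1 - 1) / (1 + 1) + exp (- ((1 - 1) * of_real (ln 2))) / (1 + 1) + 0 :: complex) = 1/2"
    by simp
  moreover have "((\<lambda>s. (s - 1) / (s + 1) + zpow 2 (s - 1) / (s + 1) + (s - 1) / (s + 1) * (\<Sum>n. zterm (n + 1) s))
      \<longlongrightarrow> (1 - 1) / (1 + 1) + exp (- ((1 - 1) * of_real (ln 2))) / (1 + 1) + 0) (at (1::complex))"
    unfolding zpow_def by (intro tendsto_add tendsto_intros t) auto
  ultimately have "((\<lambda>s. (s - 1) / (s + 1) + zpow 2 (s - 1) / (s + 1) +
      (s - 1) / (s + 1) * (\<Sum>n. zterm (n + 1) s)) \<longlongrightarrow> 1/2) (at 1)"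
    by (simp only:)
  hence "(zeta_reg \<longlongrightarrow> 1/2) (at 1)"
  proof (rule Lim_transform_eventually)
    show "\<forall>\<^sub>F s in at 1. (s - 1) / (s + 1) + zpow 2 (s - 1) / (s + 1) +
        (s - 1) / (s + 1) * (\<Sum>n. zterm (n + 1) s) = zeta_reg s"
      using near
    proof eventually_elim
      case (elim s)
      thus ?case using zeta_reg_approximation[of s 1] by (simp add: zpow_def)
    qed
  qed
  hence c1: "isCont zeta_reg 1" by (simp add: isCont_def zeta_reg_def)
  have o: "open ({s::complex. Re s > 0} - {1})" by (intro open_Diff open_halfspace_Re_gt) auto
  have "isCont zeta_reg s" if "Re s > 0" for s
    using c1 holomorphic_on_imp_continuous_on[OF hol] o that
    by (cases "s = 1") (auto simp: continuous_on_eq_continuous_at)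
  thus "continuous_on {s. Re s > 0} zeta_reg"
    by (intro continuous_at_imp_continuous_on) auto
qed (auto simp: open_halfspace_Re_gt)

section \<open>The mean square of \<open>zeta_reg\<close> on vertical lines\<close>

lemma norm_moebius_le_1: "Re s \<ge> 0 \<Longrightarrow> norm ((s - 1) / (s + 1)) \<le> 1"
proof -
  assume "Re s \<ge> 0"
  hence "norm (s - 1) \<le> norm (s + 1)"
    unfolding cmod_def by (intro real_sqrt_le_mono) (auto simp: power2_eq_square algebra_simps)
  thus ?thesis by (simp add: norm_divide divide_le_eq_1)
qed

lemma cube_powr:
  fixes x :: real
  assumes "x > 0"
  shows "(x ^ 3) powr (1/3) = x" "(x ^ 3) powr (-(2/3)) = 1 / x\<^sup>2"
proof -
  have c: "x ^ 3 = x powr 3" using assms by simp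
  show "(x ^ 3) powr (1/3) = x"
    unfolding c powr_powr using assms by simp
  have "(x ^ 3) powr (-(2/3)) = x powr (-2)"
    unfolding c powr_powr by simp
  also have "\<dots> = 1 / x\<^sup>2"
    using assms by (simp only: powr_minus_divide) simp
  finally show "(x ^ 3) powr (-(2/3)) = 1 / x\<^sup>2" .
qed

text \<open>The three parts of the approximation of length \<open>k ^ 3\<close> are squared
  separately. Up to height \<open>k ^ 2\<close> the remainder is bounded, and the square of the
  boundary term is at most \<open>2 * real k / (1 + t\<^sup>2)\<close>, whose integral over
  \<open>t\<close> is only of order \<open>k\<close>.\<close>

lemma norm_zeta_reg_squared_le:
  assumes "\<sigma> \<in> {5/6..b}" "k \<ge> 1" "\<bar>t\<bar> \<le> real k ^ 2"
  shows "(norm (zeta_reg (Complex \<sigma> t)))\<^sup>2 \<le>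
    3 * (norm (\<Sum>n=1..k ^ 3. zpow (real n) (Complex \<sigma> t)))\<^sup>2 + 6 * real k * (1 / (1 + t\<^sup>2)) + 27 * (b + 1)\<^sup>2"
proof (cases "Complex \<sigma> t = 1")
  \<comment> \<open>The approximation excludes \<open>s = 1\<close>; there \<open>t = 0\<close> and
    the middle term alone exceeds 1/4.\<close>
  case True
  have "1 \<le> 6 * real k" "t = 0" using assms(2) True by (auto simp: complex_eq_iff)
  hence "(1/2)\<^sup>2 \<le> 6 * real k * (1 / (1 + t\<^sup>2))"
    by (simp add: power2_eq_square)
  moreover have "0 \<le> 3 * (norm (\<Sum>n=1..k ^ 3. zpow (real n) (Complex \<sigma> t)))\<^sup>2" "0 \<le> 27 * (b + 1)\<^sup>2"
    by auto
  moreover have "norm (zeta_reg (Complex \<sigma> t)) = 1/2" using True by (simp add: zeta_reg_def)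
  ultimately show ?thesis by (simp only:)
next
  case False
  define s D N where "s = Complex \<sigma> t" and "D = (\<Sum>n=1..k ^ 3. zpow (real n) s)" and "N = k ^ 3"
  have s: "Re s \<ge> 5/6" "Re s > 0" "s \<noteq> 1" using assms False by (auto simp: s_def)
  have k: "real k \<ge> 1" using assms by simp
  define U V W where "U = (s - 1) / (s + 1) * D" and "V = zpow (real (Suc N)) (s - 1) / (s + 1)"
    and "W = (s - 1) / (s + 1) * (\<Sum>n. zterm (n + N) s)"
  have q: "norm ((s - 1) / (s + 1)) \<le> 1" using s by (intro norm_moebius_le_1) auto
  have U: "(norm U)\<^sup>2 \<le> (norm D)\<^sup>2"
    unfolding U_def norm_mult using q by (intro power_mono mult_left_le_one_le) auto
  have V: "(norm V)\<^sup>2 \<le> 2 * real k * (1 / (1 + t\<^sup>2))"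
  proof -
    have "norm (zpow (real (Suc N)) (s - 1)) = real (Suc N) powr (1 - \<sigma>)"
      by (simp add: norm_zpow s_def)
    also have "\<dots> \<le> real (Suc N) powr (1/6)" using assms by (intro powr_mono) auto
    finally have "(norm (zpow (real (Suc N)) (s - 1)))\<^sup>2 \<le> (real (Suc N) powr (1/6))\<^sup>2"
      by (intro power_mono) auto
    also have "\<dots> = real (Suc N) powr (1/3)"
      by (simp add: power2_eq_square del: of_nat_Suc flip: powr_add)
    also have "\<dots> \<le> ((2 * real k) ^ 3) powr (1/3)"
    proof (intro powr_mono2)
      have "1 \<le> real k ^ 3" using k by (rule one_le_power)
      thus "real (Suc N) \<le> (2 * real k) ^ 3" by (simp add: N_def power_mult_distrib)
    qed auto
    also have "\<dots> = 2 * real k"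
      using k by (intro cube_powr) auto
    finally have 1: "(norm (zpow (real (Suc N)) (s - 1)))\<^sup>2 \<le> 2 * real k" .
    have 2: "1 + t\<^sup>2 \<le> (norm (s + 1))\<^sup>2"
      unfolding cmod_power2 using s by (auto simp: s_def)
    have "(norm V)\<^sup>2 = (norm (zpow (real (Suc N)) (s - 1)))\<^sup>2 / (norm (s + 1))\<^sup>2"
      by (simp add: V_def norm_divide power_divide)
    also have "\<dots> \<le> 2 * real k / (1 + t\<^sup>2)"
      using 1 2 by (intro frac_le) (auto intro: add_pos_nonneg)
    finally show ?thesis by simp
  qed
  have W: "(norm W)\<^sup>2 \<le> 9 * (b + 1)\<^sup>2"
  proof -
    have "norm s \<le> \<bar>\<sigma>\<bar> + \<bar>t\<bar>" using cmod_le[of s] by (simp add: s_def)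
    also have "\<dots> \<le> b * real k ^ 2 + 1 * real k ^ 2"
      using assms k one_le_power[of "real k" 2] mult_mono[of \<sigma> b 1 "real k ^ 2"] by auto
    finally have ns: "norm s \<le> (b + 1) * real k ^ 2" by (simp add: algebra_simps)
    have "norm W \<le> norm (\<Sum>n. zterm (n + N) s)"
      unfolding W_def norm_mult using q by (intro mult_left_le_one_le) auto
    also have "\<dots> \<le> 3 * norm s * real N powr (-(2/3))"
      using s k by (intro norm_zterm_tail_le) (auto simp: N_def Suc_le_eq)
    also have "real N powr (-(2/3)) = 1 / real k ^ 2"
      using cube_powr(2)[of "real k"] k by (simp add: N_def)
    also have "3 * norm s * (1 / real k ^ 2) \<le> 3 * (b + 1)"
      using ns k by (simp add: field_simps)
    finally have "(norm W)\<^sup>2 \<le> (3 * (b + 1))\<^sup>2" by (rule power_mono) auto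
    also have "\<dots> = 9 * (b + 1)\<^sup>2" unfolding power_mult_distrib by simp
    finally show ?thesis .
  qed
  have "norm (zeta_reg s) \<le> norm U + norm V + norm W"
    unfolding zeta_reg_approximation[OF s(2,3), of N] U_def V_def W_def D_def N_def
    by (intro norm_triangle_le add_mono norm_triangle_ineq) auto
  hence "(norm (zeta_reg s))\<^sup>2 \<le> (norm U + norm V + norm W)\<^sup>2" by (intro power_mono) auto
  also have "\<dots> \<le> 3 * (norm U)\<^sup>2 + 3 * (norm V)\<^sup>2 + 3 * (norm W)\<^sup>2"
    using sum_squares_bound[of "norm U" "norm V"] sum_squares_bound[of "norm U" "norm W"]
      sum_squares_bound[of "norm V" "norm W"] by (simp add: power2_eq_square algebra_simps)
  also have "\<dots> \<le> 3 * (norm D)\<^sup>2 + 3 * (2 * real k * (1 / (1 + t\<^sup>2))) + 3 * (9 * (b + 1)\<^sup>2)"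
    using U V W by (intro add_mono mult_left_mono) auto
  finally show ?thesis by (simp add: s_def D_def)
qed

lemma continuous_zeta_reg_squared:
  "0 < a \<Longrightarrow> continuous_on {s. Re s \<in> {a..b}} (\<lambda>s. (norm (zeta_reg s))\<^sup>2)"
  by (intro continuous_intros holomorphic_on_imp_continuous_on
      holomorphic_on_subset[OF holomorphic_zeta_reg]) auto

lemma zeta_reg_mean_square_squares:
  assumes "\<sigma> \<in> {5/6..b}" "k \<ge> 1"
  shows "integral {- (real k ^ 2)..real k ^ 2} (\<lambda>t. (norm (zeta_reg (Complex \<sigma> t)))\<^sup>2)
    \<le> (210 + 54 * (b + 1)\<^sup>2) * real k ^ 2"
proof -
  define T where "T = real k ^ 2"
  have k: "real k \<ge> 1" and T: "T \<ge> 0" using assms by (auto simp: T_def)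
  have kp: "real (k ^ 3) powr (1/3) = k"
    using cube_powr(1)[of "real k"] k by simp
  let ?D = "\<lambda>t. (norm (\<Sum>n=1..k ^ 3. zpow (real n) (Complex \<sigma> t)))\<^sup>2"
  let ?I = "\<lambda>t::real. 1 / (1 + t\<^sup>2)"
  have D: "?D integrable_on {-T..T}"
    unfolding norm_sum_zpow_squared by (intro integrable_continuous_interval continuous_intros)
  have I: "(?I has_integral (arctan T - arctan (-T))) {-T..T}"
    using T by (intro fundamental_theorem_of_calculus)
      (auto intro!: derivative_eq_intros simp: inverse_eq_divide
        simp flip: has_real_derivative_iff_has_vector_derivative)
  have "integral {-T..T} (\<lambda>t. (norm (zeta_reg (Complex \<sigma> t)))\<^sup>2)
      \<le> integral {-T..T} (\<lambda>t. 3 * ?D t + 6 * real k * ?I t + 27 * (b + 1)\<^sup>2)"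
  proof (rule integral_le)
    show "(\<lambda>t. (norm (zeta_reg (Complex \<sigma> t)))\<^sup>2) integrable_on {-T..T}"
      using assms by (intro integrable_continuous_interval
        continuous_on_vertical[OF continuous_zeta_reg_squared[of "5/6" b]]) auto
    show "(\<lambda>t. 3 * ?D t + 6 * real k * ?I t + 27 * (b + 1)\<^sup>2) integrable_on {-T..T}"
      using D I by (intro integrable_add integrable_on_mult_right integrable_const_ivl) blast+
    fix t assume "t \<in> {-T..T}"
    thus "(norm (zeta_reg (Complex \<sigma> t)))\<^sup>2 \<le> 3 * ?D t + 6 * real k * ?I t + 27 * (b + 1)\<^sup>2"
      by (intro norm_zeta_reg_squared_le assms) (auto simp: T_def)
  qed
  also have "\<dots> = 3 * integral {-T..T} ?D + 6 * real k * (arctan T - arctan (-T)) + 27 * (b + 1)\<^sup>2 * (2 * T)"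
  proof (rule integral_unique, intro has_integral_add has_integral_mult_right)
    show "(?D has_integral integral {-T..T} ?D) {-T..T}" using D by (rule integrable_integral)
    show "(?I has_integral (arctan T - arctan (-T))) {-T..T}" by (rule I)
    show "((\<lambda>t. 27 * (b + 1)\<^sup>2) has_integral (27 * (b + 1)\<^sup>2 * (2 * T))) {-T..T}"
      using has_integral_const_real[of "27 * (b + 1)\<^sup>2" "-T" T] T by (simp add: mult_ac)
  qed
  \<comment> \<open>Here \<open>62 = 8 + 54\<close> comes from the polynomial and 4 bounds
    \<open>pi\<close>; together \<open>3 * 62 + 6 * 4 = 210\<close>.\<close>
  also have "\<dots> \<le> 3 * (62 * real k ^ 2) + 6 * real k * 4 + 27 * (b + 1)\<^sup>2 * (2 * T)"
  proof (intro add_mono mult_left_mono)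
    have "integral {-T..T} ?D \<le> 8 * T + 54 * (real (k ^ 3) powr (1/3))\<^sup>2"
      using assms T by (intro dirichlet_polynomial_mean_square) auto
    thus "integral {-T..T} ?D \<le> 62 * real k ^ 2" using kp by (simp add: T_def)
    show "arctan T - arctan (-T) \<le> 4"
      using arctan_ubound[of T] arctan_lbound[of "-T"] pi_less_4 by simp
  qed auto
  also have "\<dots> \<le> (210 + 54 * (b + 1)\<^sup>2) * real k ^ 2"
    using k self_le_power[of "real k" 2] by (simp add: T_def algebra_simps)
  finally show ?thesis by (simp add: T_def)
qed

lemma zeta_reg_mean_square:
  assumes "\<sigma> \<in> {5/6..b}" "T \<ge> 0"
  shows "integral {-T..T} (\<lambda>t. (norm (zeta_reg (Complex \<sigma> t)))\<^sup>2)
    \<le> 8 * (210 + 54 * (b + 1)\<^sup>2) * (T + 1)"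
proof -
  \<comment> \<open>The height is rounded up to the square of an integer; the added 1 keeps
    \<open>k\<close> positive when \<open>T = 0\<close>.\<close>
  define k where "k = nat \<lceil>sqrt T\<rceil> + 1"
  have k: "sqrt T \<le> real k" "real k \<le> sqrt T + 2" "k \<ge> 1"
    using assms(2) real_sqrt_ge_zero[of T] unfolding k_def by linarith+
  have "T \<le> real k ^ 2" using k(1) assms(2) by (simp add: sqrt_le_D)
  have "real k ^ 2 \<le> (sqrt T + 2)\<^sup>2" using k by (intro power_mono) auto
  also have "\<dots> \<le> 2 * (sqrt T)\<^sup>2 + 8"
    using sum_squares_bound[of "sqrt T" 2] by (simp add: power2_eq_square algebra_simps)
  also have "\<dots> \<le> 8 * (T + 1)" using assms(2) by simp
  finally have k2: "real k ^ 2 \<le> 8 * (T + 1)" .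
  have "integral {-T..T} (\<lambda>t. (norm (zeta_reg (Complex \<sigma> t)))\<^sup>2)
      \<le> integral {- (real k ^ 2)..real k ^ 2} (\<lambda>t. (norm (zeta_reg (Complex \<sigma> t)))\<^sup>2)"
    using assms \<open>T \<le> real k ^ 2\<close>
    by (intro integral_subset_le integrable_continuous_interval
        continuous_on_vertical[OF continuous_zeta_reg_squared[of "5/6" b]]) auto
  also have "\<dots> \<le> (210 + 54 * (b + 1)\<^sup>2) * real k ^ 2"
    by (rule zeta_reg_mean_square_squares[OF assms(1) k(3)])
  also have "\<dots> \<le> (210 + 54 * (b + 1)\<^sup>2) * (8 * (T + 1))"
    by (intro mult_left_mono k2) auto
  finally show ?thesis by (simp only: mult_ac)
qed

section \<open>The zeros of \<open>\<nu>\<close>\<close>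

lemma norm_zeta_remainder_le:
  obtains K where "K \<ge> 0"
    "\<And>s. Re s \<ge> 2 \<Longrightarrow> norm (zeta s - (1 + zpow 2 s)) \<le> K * 3 powr (- Re s)"
proof
  let ?b = "\<lambda>n. real (n + 3) powr (-2)"
  have b: "summable ?b"
    using summable_real_powr_iff[of "-2"] summable_iff_shift[of "\<lambda>n. real n powr (-2)" 3] by simp
  show "9 * suminf ?b \<ge> 0" using suminf_nonneg[OF b] by simp
  fix s :: complex assume s: "Re s \<ge> 2"
  have "(\<lambda>n. of_nat (Suc n) powr (- s)) sums zeta s"
    using s is_zeta_continuation_zeta by (simp add: is_zeta_continuation_def)
  hence z: "(\<lambda>n. zpow (real (Suc n)) s) sums zeta s" using zpow_of_nat[of "Suc _" s] by simp
  have "(\<Sum>n<2. zpow (real (Suc n)) s) = 1 + zpow 2 s"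
    by (simp add: numeral_2_eq_2) (simp add: zpow_def)
  hence "zeta s - (1 + zpow 2 s) = (\<Sum>n. zpow (real (n + 3)) s)"
    using suminf_minus_initial_segment[OF sums_summable[OF z], of 2] sums_unique[OF z]
    by (simp add: add_ac eval_nat_numeral)
  also have "norm \<dots> \<le> (\<Sum>n. 3 powr (2 - Re s) * ?b n)"
  proof (rule norm_suminf_le)
    fix n
    \<comment> \<open>Splitting off the exponent -2 secures convergence; the remaining power
      decreases in \<open>n\<close>, so its value at 3 bounds it.\<close>
    have "norm (zpow (real (n + 3)) s) = real (n + 3) powr (2 - Re s) * ?b n"
      by (simp add: norm_zpow flip: powr_add)
    also have "\<dots> \<le> 3 powr (2 - Re s) * ?b n"
      using s by (intro mult_right_mono powr_mono2') auto
    finally show "norm (zpow (real (n + 3)) s) \<le> 3 powr (2 - Re s) * ?b n" .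
  qed (intro summable_mult b)
  also have "\<dots> = 3 powr (2 - Re s) * suminf ?b" by (rule suminf_mult[OF b])
  also have "3 powr (2 - Re s) = 9 * 3 powr (- Re s)"
    using powr_add[of 3 2 "- Re s"] by simp
  finally show "norm (zeta s - (1 + zpow 2 s)) \<le> 9 * suminf ?b * 3 powr (- Re s)"
    by (simp add: mult_ac)
qed

text \<open>Cauchy's formula on unit circles carries the remainder bound over to derivatives.
  \<open>Re s \<ge> 3\<close> keeps the circles where that bound holds; moving left by 1 costs a
  factor 3, and \<open>fact k\<close> at most 2.\<close>

lemma norm_deriv_zeta_remainder_le:
  obtains K where "K \<ge> 0"
    "\<And>s k. Re s \<ge> 3 \<Longrightarrow> k \<le> 2 \<Longrightarrow>
      norm ((deriv ^^ k) zeta s - (deriv ^^ k) (\<lambda>s. 1 + zpow 2 s) s) \<le> K * 3 powr (- Re s)"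
proof -
  obtain K where K: "K \<ge> 0"
    "\<And>s. Re s \<ge> 2 \<Longrightarrow> norm (zeta s - (1 + zpow 2 s)) \<le> K * 3 powr (- Re s)"
    using norm_zeta_remainder_le by blast
  let ?r = "\<lambda>s. zeta s - (1 + zpow 2 s)" and ?S = "- {1::complex}"
  have hol: "?r holomorphic_on ?S" by (intro holomorphic_intros holomorphic_zeta)
  show ?thesis
  proof (rule that[of "6 * K"])
    fix s :: complex and k :: nat assume s: "Re s \<ge> 3" and k: "k \<le> 2"
    have sub: "cball s 1 \<subseteq> ?S"
    proof
      fix z assume "z \<in> cball s 1"
      thus "z \<in> ?S" using s abs_Re_le_cmod[of "s - z"] by (auto simp: dist_norm)
    qed
    have re: "Re (circlepath s 1 x) \<ge> Re s - 1" for x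
      using circlepath_Complex[of "Re s" "Im s" 1 x] by simp
    have "norm ((deriv ^^ k) ?r s) \<le> fact k / 1 ^ k * integral {0..1} (\<lambda>x. norm (?r (circlepath s 1 x)))"
      by (rule norm_higher_deriv_le_circle_mean[OF hol _ sub]) auto
    also have "integral {0..1} (\<lambda>x. norm (?r (circlepath s 1 x)))
        \<le> integral {0..1::real} (\<lambda>x. 3 * K * 3 powr (- Re s))"
    proof (rule integral_le)
      have "continuous_on (cball s 1) ?r"
        using hol sub by (intro holomorphic_on_imp_continuous_on holomorphic_on_subset[OF hol])
      thus "(\<lambda>x. norm (?r (circlepath s 1 x))) integrable_on {0..1}"
        by (intro integrable_continuous_interval continuous_on_norm
            continuous_on_circle[where f = ?r]) auto
      fix x
      have "norm (?r (circlepath s 1 x)) \<le> K * 3 powr (- Re (circlepath s 1 x))"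
        using re[of x] s by (intro K) auto
      also have "\<dots> \<le> K * 3 powr (1 + - Re s)"
        using re[of x] K by (intro mult_left_mono powr_mono) auto
      also have "\<dots> = 3 * K * 3 powr (- Re s)" unfolding powr_add by simp
      finally show "norm (?r (circlepath s 1 x)) \<le> 3 * K * 3 powr (- Re s)" .
    qed auto
    also have "fact k / 1 ^ k * integral {0..1::real} (\<lambda>x. 3 * K * 3 powr (- Re s))
        \<le> 2 * (3 * K * 3 powr (- Re s))"
    proof -
      have "fact k \<le> (2::real)" using fact_mono[OF k, where 'a = real] by simp
      hence "fact k * (3 * K * 3 powr (- Re s)) \<le> 2 * (3 * K * 3 powr (- Re s))"
        using K(1) by (intro mult_right_mono) auto
      thus ?thesis by simp
    qed
    finally have "norm ((deriv ^^ k) ?r s) \<le> 6 * K * 3 powr (- Re s)" by simp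
    moreover have "(deriv ^^ k) ?r s = (deriv ^^ k) zeta s - (deriv ^^ k) (\<lambda>s. 1 + zpow 2 s) s"
      by (rule higher_deriv_diff[OF holomorphic_zeta]) (use s in \<open>auto intro!: holomorphic_intros\<close>)
    ultimately show "norm ((deriv ^^ k) zeta s - (deriv ^^ k) (\<lambda>s. 1 + zpow 2 s) s)
        \<le> 6 * K * 3 powr (- Re s)" by simp
  qed (use K in auto)
qed

lemma deriv_zpow_2:
  "deriv (\<lambda>s. 1 + zpow 2 s) = (\<lambda>s. - (of_real (ln 2) * zpow 2 s))"
  "deriv (\<lambda>s. - (of_real (ln 2) * zpow 2 s)) = (\<lambda>s. of_real (ln 2) ^ 2 * zpow 2 s)"
  unfolding zpow_def
  by (intro ext DERIV_imp_deriv; auto intro!: derivative_eq_intros simp: power2_eq_square)+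

text \<open>With \<open>a = zpow 2 s\<close> and \<open>L = ln 2\<close>, zeta and its two
  derivatives are close to \<open>1 + a\<close>, \<open>- L * a\<close> and
  \<open>L\<^sup>2 * a\<close>, so the main term of \<open>nu\<close> is
  \<open>L\<^sup>2 * a\<close>. All else is of order \<open>3 powr (- Re s)\<close> or
  \<open>4 powr (- Re s)\<close>.\<close>

lemma nu_lower_bound:
  obtains c where
    "\<And>s. Re s \<ge> c \<Longrightarrow> (ln 2)\<^sup>2 / 2 * 2 powr (- Re s) \<le> norm (nu s)"
proof -
  define L where "L = ln (2::real)"
  have L: "0 < L" "L \<le> 1" using ln_2_less_1 by (auto simp: L_def)
  obtain K where K: "K \<ge> 0"
    "\<And>s k. Re s \<ge> 3 \<Longrightarrow> k \<le> 2 \<Longrightarrow>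
      norm ((deriv ^^ k) zeta s - (deriv ^^ k) (\<lambda>s. 1 + zpow 2 s) s) \<le> K * 3 powr (- Re s)"
    using norm_deriv_zeta_remainder_le by blast
  \<comment> \<open>This is the error relative to \<open>2 powr (- x)\<close>; from some
    \<open>c0\<close> on it takes less than half of the main term.\<close>
  have "((\<lambda>x. K * (2/3) powr x + 2 * ((1 + K)\<^sup>2 * 2 powr (- x))) \<longlongrightarrow> K * 0 + 2 * ((1 + K)\<^sup>2 * 0)) at_top"
    by (intro tendsto_intros; real_asymp)
  moreover have "K * 0 + 2 * ((1 + K)\<^sup>2 * 0) < L\<^sup>2 / 2" using L by simp
  ultimately have "eventually (\<lambda>x. K * (2/3) powr x + 2 * ((1 + K)\<^sup>2 * 2 powr (- x)) < L\<^sup>2 / 2) at_top"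
    by (rule order_tendstoD)
  then obtain c0 where c0: "\<And>x. x \<ge> c0 \<Longrightarrow> K * (2/3) powr x + 2 * ((1 + K)\<^sup>2 * 2 powr (- x)) < L\<^sup>2 / 2"
    unfolding eventually_at_top_linorder by blast
  show ?thesis
  proof (rule that[of "max 3 c0"])
    fix s assume "Re s \<ge> max 3 c0"
    hence s: "Re s \<ge> 3" "Re s \<ge> c0" by auto
    define a A B where "a = zpow 2 s" and "A = 2 powr (- Re s)" and "B = K * 3 powr (- Re s)"
    define r0 r1 r2 where "r0 = zeta s - (1 + a)" and "r1 = deriv zeta s - (- of_real L * a)"
      and "r2 = deriv (deriv zeta) s - of_real L ^ 2 * a"
    have deriv2: "(deriv ^^ 2) f = deriv (deriv f)" for f :: "complex \<Rightarrow> complex"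
      by (simp add: numeral_2_eq_2)
    have a: "norm a = A" by (simp add: a_def A_def norm_zpow)
    have r: "norm r0 \<le> B" "norm r1 \<le> B" "norm r2 \<le> B"
      using K(2)[OF s(1), of 0] K(2)[OF s(1), of 1] K(2)[OF s(1), of 2]
      by (simp_all add: r0_def r1_def r2_def a_def B_def L_def deriv_zpow_2 deriv2)
    have "3 powr (- Re s) \<le> 2 powr (- Re s)" using s by (intro powr_mono2') auto
    hence AB: "B \<le> K * A" "A > 0" "B \<ge> 0"
      unfolding A_def B_def using K(1) by (simp_all add: mult_left_mono)
    define E where "E = r2 + ((a + r0) * (of_real L ^ 2 * a + r2) - (- of_real L * a + r1) ^ 2)"
    have nu: "nu s = of_real L ^ 2 * a + E"
      by (simp add: nu_def E_def r0_def r1_def r2_def deriv2 algebra_simps)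
    have n1: "norm (a + r0) \<le> A + B" using norm_triangle_ineq[of a r0] a r by linarith
    have "L\<^sup>2 * A \<le> A" "L * A \<le> A"
      using L AB by (auto intro!: mult_left_le_one_le power_le_one)
    hence n2: "norm (of_real L ^ 2 * a + r2) \<le> A + B" and n3: "norm (- of_real L * a + r1) \<le> A + B"
      using norm_triangle_ineq[of "of_real L ^ 2 * a" r2] norm_triangle_ineq[of "- of_real L * a" r1] a r L
      by (auto simp: norm_mult norm_power)
    have "norm E \<le> norm r2 + (norm (a + r0) * norm (of_real L ^ 2 * a + r2) + (norm (- of_real L * a + r1))\<^sup>2)"
      unfolding E_def
      by (intro norm_triangle_le add_mono norm_triangle_le_diff order.refl)
         (auto simp: norm_mult norm_power)
    also have "\<dots> \<le> B + ((A + B) * (A + B) + (A + B)\<^sup>2)"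
      using r n1 n2 n3 AB by (intro add_mono mult_mono power_mono) auto
    also have "\<dots> = B + 2 * (A + B)\<^sup>2" by (simp add: power2_eq_square)
    also have "\<dots> \<le> B + 2 * ((1 + K) * A)\<^sup>2"
      using AB by (intro add_mono mult_left_mono power_mono) (auto simp: algebra_simps)
    also have "\<dots> = A * (K * (2/3) powr Re s + 2 * ((1 + K)\<^sup>2 * 2 powr (- Re s)))"
    proof -
      have "B = A * (K * (2/3) powr Re s)"
        by (simp add: A_def B_def powr_divide powr_minus field_simps)
      thus ?thesis by (simp add: power_mult_distrib power2_eq_square algebra_simps A_def)
    qed
    also have "\<dots> \<le> A * (L\<^sup>2 / 2)" using c0[OF s(2)] AB by (intro mult_left_mono) auto
    finally have "norm E \<le> A * (L\<^sup>2 / 2)" .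
    moreover have "L\<^sup>2 * A \<le> norm (nu s) + norm E"
      using norm_triangle_ineq4[of "nu s" E] nu a L by (simp add: norm_mult norm_power)
    ultimately have "L\<^sup>2 / 2 * A \<le> norm (nu s)" by (simp add: mult.commute)
    thus "(ln 2)\<^sup>2 / 2 * 2 powr (- Re s) \<le> norm (nu s)" by (simp only: A_def L_def)
  qed
qed

text \<open>
  With \<open>q s = (s - 1) / (s + 1)\<close>, the last summand is \<open>(q'\<^sup>2 - q q'') (zeta_reg s)\<^sup>2\<close>; the sum
  is \<open>q ^ 4\<close> times \<open>nu\<close>, since \<open>f f'' - f'\<^sup>2 = f\<^sup>2 (f' / f)'\<close> turns products into sums.
\<close>
definition nu_reg :: "complex \<Rightarrow> complex" where
  "nu_reg s = ((s - 1) / (s + 1))\<^sup>2 * (zeta_reg s * (deriv ^^ 2) zeta_reg s - (deriv zeta_reg s)\<^sup>2)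
     + 4 * s / (s + 1) ^ 4 * (zeta_reg s)\<^sup>2"

section \<open>Zeros and mean values of \<open>nu_reg\<close>\<close>

lemma holomorphic_nu_reg: "nu_reg holomorphic_on {s. Re s > 0}"
proof -
  have "(deriv ^^ 2) zeta_reg holomorphic_on {s. Re s > 0}"
    by (intro holomorphic_higher_deriv holomorphic_zeta_reg open_halfspace_Re_gt)
  moreover have "deriv zeta_reg holomorphic_on {s. Re s > 0}"
    by (intro holomorphic_deriv holomorphic_zeta_reg open_halfspace_Re_gt)
  ultimately show ?thesis
    unfolding nu_reg_def using Re_pos_neq
    by (intro holomorphic_intros holomorphic_zeta_reg) (auto simp: open_halfspace_Re_gt)
qed

lemma nu_reg_eq:
  assumes "Re s > 0" "s \<noteq> 1"
  shows "nu_reg s = ((s - 1) / (s + 1)) ^ 4 * nu s"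
proof -
  let ?S = "{s::complex. Re s > 0} - {1}"
  let ?d1 = "\<lambda>w. 2 / (w + 1)\<^sup>2 * zeta w + (w - 1) / (w + 1) * deriv zeta w"
  let ?d2 = "\<lambda>w. - 4 / (w + 1) ^ 3 * zeta w + 2 * (2 / (w + 1)\<^sup>2) * deriv zeta w
     + (w - 1) / (w + 1) * deriv (deriv zeta) w"
  have S: "open ?S" by (intro open_Diff open_halfspace_Re_gt) auto
  have z1: "(zeta has_field_derivative deriv zeta w) (at w)" if "w \<in> ?S" for w
    using that by (intro holomorphic_derivI[OF holomorphic_zeta]) auto
  have z2: "(deriv zeta has_field_derivative deriv (deriv zeta) w) (at w)" if "w \<in> ?S" for w
    using that by (intro holomorphic_derivI[OF holomorphic_deriv[OF holomorphic_zeta]]) auto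
  have q1: "((\<lambda>w. (w - 1) / (w + 1)) has_field_derivative 2 / (w + 1)\<^sup>2) (at w)"
    and q2: "((\<lambda>w. 2 / (w + 1)\<^sup>2) has_field_derivative - 4 / (w + 1) ^ 3) (at w)"
    if "w \<in> ?S" for w
    using Re_pos_neq[of w] that
    by (auto intro!: derivative_eq_intros simp: divide_simps power2_eq_square power3_eq_cube)
  have D1: "(zeta_reg has_field_derivative ?d1 w) (at w)" if w: "w \<in> ?S" for w
  proof (rule has_field_derivative_transform_within_open[OF _ S w])
    show "((\<lambda>w. (w - 1) / (w + 1) * zeta w) has_field_derivative ?d1 w) (at w)"
      by (rule DERIV_cong[OF DERIV_mult[OF q1[OF w] z1[OF w]]]) (simp add: mult_ac)
  qed (auto simp: zeta_reg_def)
  hence d1: "deriv zeta_reg w = ?d1 w" if "w \<in> ?S" for w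
    using that by (intro DERIV_imp_deriv) auto
  have sS: "s \<in> ?S" using assms by simp
  have "(deriv zeta_reg has_field_derivative ?d2 s) (at s)"
  proof (rule has_field_derivative_transform_within_open[OF _ S sS])
    show "(?d1 has_field_derivative ?d2 s) (at s)"
      by (rule DERIV_cong[OF DERIV_add[OF DERIV_mult[OF q2[OF sS] z1[OF sS]]
            DERIV_mult[OF q1[OF sS] z2[OF sS]]]]) (simp add: algebra_simps)
  qed (simp add: d1)
  hence d2: "deriv (deriv zeta_reg) s = ?d2 s" by (rule DERIV_imp_deriv)
  \<comment> \<open>\<open>u\<close> and \<open>v\<close> are the first two derivatives of
    \<open>q\<close>. The extra summand of \<open>nu_reg\<close> cancels what remains of the terms
    in which \<open>q\<close> is differentiated.\<close>
  define q u v where "q = (s - 1) / (s + 1)" and "u = 2 / (s + 1)\<^sup>2" and "v = - 4 / (s + 1) ^ 3"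
  have "4 * s / (s + 1) ^ 4 = u\<^sup>2 - q * v"
  proof -
    have "u\<^sup>2 = 4 / (s + 1) ^ 4" by (simp add: u_def power_divide flip: power_mult)
    moreover have "q * v = (4 - 4 * s) / (s + 1) ^ 4"
    proof -
      have "q * v = (s - 1) * (- 4) / ((s + 1) * (s + 1) ^ 3)"
        by (simp only: q_def v_def times_divide_times_eq)
      also have "(s - 1) * (- 4) = 4 - 4 * s" by algebra
      also have "(s + 1) * (s + 1) ^ 3 = (s + 1) ^ 4" by (simp add: eval_nat_numeral)
      finally show ?thesis .
    qed
    ultimately have "u\<^sup>2 - q * v = (4 - (4 - 4 * s)) / (s + 1) ^ 4"
      by (simp only: diff_divide_distrib)
    also have "4 - (4 - 4 * s) = 4 * s" by simp
    finally show ?thesis by (rule sym)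
  qed
  moreover have "zeta_reg s = q * zeta s" using assms by (simp add: zeta_reg_def q_def)
  ultimately have "nu_reg s = q\<^sup>2 * (q * zeta s * (v * zeta s + 2 * u * deriv zeta s + q * deriv (deriv zeta) s)
      - (u * zeta s + q * deriv zeta s)\<^sup>2) + (u\<^sup>2 - q * v) * (q * zeta s)\<^sup>2"
    unfolding nu_reg_def using d1[OF sS] d2 by (simp add: numeral_2_eq_2 q_def u_def v_def)
  also have "\<dots> = q ^ 4 * nu s"
    unfolding nu_def by (simp add: numeral_2_eq_2) algebra
  finally show ?thesis by (simp add: q_def)
qed

text \<open>Near such a point the quotient of \<open>nu_reg\<close> by \<open>nu\<close> is
  holomorphic and nonzero, so multiplicities may be counted for \<open>nu_reg\<close>.\<close>

lemma zorder_nu_reg: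
  assumes "Re s > 0" "s \<noteq> 1" "\<exists>w. Re w > 0 \<and> nu_reg w \<noteq> 0"
  shows "zorder nu s = zorder nu_reg s"
proof -
  have conn: "connected {s::complex. Re s > 0}"
    by (intro convex_connected convex_halfspace_Re_gt)
  define g n where "g = zor_poly nu_reg s" and "n = zorder nu_reg s"
  have "\<exists>w\<in>{s. Re s > 0}. nu_reg w \<noteq> 0" "s \<in> {s. Re s > 0}" using assms by auto
  note Z = zorder_exist_zero[OF holomorphic_nu_reg open_halfspace_Re_gt conn this(2,1)]
  have n: "n \<ge> 0" using conjunct1[OF Z] unfolding n_def by (simp split: if_splits)
  obtain r where r: "r > 0" "cball s r \<subseteq> {s. Re s > 0}" "g holomorphic_on cball s r"
    and g: "\<And>w. w \<in> cball s r \<Longrightarrow> nu_reg w = g w * (w - s) ^ nat n \<and> g w \<noteq> 0"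
    using conjunct2[OF Z] unfolding g_def n_def by blast
  define S where "S = ball s r - {1}"
  have SR: "Re w > 0" "w \<noteq> 1" "w \<in> cball s r" if "w \<in> S" for w
    using that subsetD[OF r(2), of w] by (auto simp: S_def)
  show ?thesis unfolding n_def [symmetric]
  proof (rule zorder_eqI[of S])
    show "(\<lambda>w. g w / ((w - 1) / (w + 1)) ^ 4) holomorphic_on S"
      using SR Re_pos_neq by (intro holomorphic_intros holomorphic_on_subset[OF r(3)]) auto
    show "g s / ((s - 1) / (s + 1)) ^ 4 \<noteq> 0"
      using g[of s] r(1) assms Re_pos_neq by auto
    fix w assume "w \<in> S"
    thus "nu w = g w / ((w - 1) / (w + 1)) ^ 4 * (w - s) powi n"
      using nu_reg_eq[of w] g[of w] SR[of w] Re_pos_neq[of w] n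
      by (auto simp: power_int_def field_simps)
  qed (use r assms in \<open>auto simp: S_def\<close>)
qed

text \<open>Reduces the mean of \<open>nu_reg\<close> to mean squares. The Moebius factor is at most
  1 in modulus and the weight \<open>4 * s / (s + 1) ^ 4\<close> at most 4, whence
  \<open>5 = 1 + 4\<close>.\<close>

lemma norm_nu_reg_le:
  assumes "Re s > 0"
  shows "norm (nu_reg s) \<le> 5 * (norm (zeta_reg s))\<^sup>2 + (norm (deriv zeta_reg s))\<^sup>2
    + (norm ((deriv ^^ 2) zeta_reg s))\<^sup>2"
proof -
  define q where "q = ((s - 1) / (s + 1))\<^sup>2"
  define x y z where "x = zeta_reg s" and "y = deriv zeta_reg s" and "z = (deriv ^^ 2) zeta_reg s"
  have q: "norm q \<le> 1"
    unfolding q_def norm_power using norm_moebius_le_1[of s] assms by (intro power_le_one) auto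
  have s1: "norm (s + 1) \<ge> 1" using complex_Re_le_cmod[of "s + 1"] assms by simp
  have "norm s \<le> norm (s + 1)"
    unfolding cmod_def using assms by (intro real_sqrt_le_mono) (auto simp: power2_eq_square algebra_simps)
  also have "\<dots> \<le> norm (s + 1) ^ 4" using s1 by (intro self_le_power) auto
  finally have "norm (4 * s / (s + 1) ^ 4) \<le> 4"
    using s1 by (simp add: norm_mult norm_divide norm_power divide_le_eq)
  hence w: "norm (4 * s / (s + 1) ^ 4 * x\<^sup>2) \<le> 4 * (norm x)\<^sup>2"
    unfolding norm_mult norm_power[of x] by (rule mult_right_mono) auto
  have "norm (q * (x * z - y\<^sup>2)) \<le> norm (x * z - y\<^sup>2)"
    unfolding norm_mult[of q] using q by (intro mult_left_le_one_le) auto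
  also have "\<dots> \<le> norm x * norm z + (norm y)\<^sup>2"
    using norm_triangle_ineq4[of "x * z" "y\<^sup>2"] by (simp add: norm_mult norm_power)
  also have "norm x * norm z \<le> (norm x)\<^sup>2 + (norm z)\<^sup>2"
  proof -
    have "0 \<le> norm x * norm z" by simp
    thus ?thesis using sum_squares_bound[of "norm x" "norm z"] by linarith
  qed
  finally have "norm (q * (x * z - y\<^sup>2)) \<le> (norm x)\<^sup>2 + (norm z)\<^sup>2 + (norm y)\<^sup>2" by simp
  thus ?thesis
    using norm_triangle_ineq[of "q * (x * z - y\<^sup>2)" "4 * s / (s + 1) ^ 4 * x\<^sup>2"] w
    unfolding nu_reg_def q_def x_def y_def z_def by linarith
qed

text \<open>Cauchy's formula followed by Cauchy-Schwarz, so that mean squares of derivatives reduce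
  to that of \<open>zeta_reg\<close>.\<close>

lemma norm_deriv_zeta_reg_squared_le:
  assumes "\<rho> > 0" "Re s > \<rho>"
  shows "(norm ((deriv ^^ k) zeta_reg s))\<^sup>2 \<le>
    (fact k / \<rho> ^ k)\<^sup>2 * integral {0..1} (\<lambda>x. (norm (zeta_reg (circlepath s \<rho> x)))\<^sup>2)"
proof -
  have sub: "cball s \<rho> \<subseteq> {s. Re s > 0}"
  proof
    fix z assume "z \<in> cball s \<rho>"
    thus "z \<in> {s. Re s > 0}" using assms abs_Re_le_cmod[of "s - z"] by (auto simp: dist_norm)
  qed
  have "continuous_on (cball s \<rho>) zeta_reg"
    using sub by (intro holomorphic_on_imp_continuous_on holomorphic_on_subset[OF holomorphic_zeta_reg])
  hence "continuous_on {0..1} (\<lambda>x. norm (zeta_reg (circlepath s \<rho> x)))"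
    using assms(1) by (intro continuous_on_norm continuous_on_circle) auto
  from power2_integral_le[OF this]
  have "(fact k / \<rho> ^ k * integral {0..1} (\<lambda>x. norm (zeta_reg (circlepath s \<rho> x))))\<^sup>2 \<le>
      (fact k / \<rho> ^ k)\<^sup>2 * integral {0..1} (\<lambda>x. (norm (zeta_reg (circlepath s \<rho> x)))\<^sup>2)"
    unfolding power_mult_distrib by (rule mult_left_mono) auto
  moreover have "norm ((deriv ^^ k) zeta_reg s)
      \<le> fact k / \<rho> ^ k * integral {0..1} (\<lambda>x. norm (zeta_reg (circlepath s \<rho> x)))"
    by (rule norm_higher_deriv_le_circle_mean[OF holomorphic_zeta_reg open_halfspace_Re_gt sub assms(1)])
  hence "(norm ((deriv ^^ k) zeta_reg s))\<^sup>2
      \<le> (fact k / \<rho> ^ k * integral {0..1} (\<lambda>x. norm (zeta_reg (circlepath s \<rho> x))))\<^sup>2"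
    by (rule power_mono) auto
  ultimately show ?thesis by linarith
qed

lemma nu_reg_mean:
  assumes "\<rho> > 0"
  obtains C where "C \<ge> 0" "\<And>\<sigma> T. \<sigma> \<in> {5/6 + \<rho>..b} \<Longrightarrow> T \<ge> 0 \<Longrightarrow>
    integral {-T..T} (\<lambda>t. norm (nu_reg (Complex \<sigma> t))) \<le> C * (T + 1)"
proof -
  \<comment> \<open>The squared Cauchy constants for \<open>k = 0, 1, 2\<close>, the first weighted
    by 5. The distance \<open>\<rho>\<close> from 5/6 is the room for the circles.\<close>
  define Q where "Q = 5 + (1 / \<rho>)\<^sup>2 + (2 / \<rho>\<^sup>2)\<^sup>2"
  define C where "C = 8 * (210 + 54 * (b + \<rho> + 1)\<^sup>2)"
  let ?F = "\<lambda>s. (norm (zeta_reg s))\<^sup>2"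
  let ?M = "\<lambda>s. integral {0..1} (\<lambda>x. ?F (circlepath s \<rho> x))"
  have Q: "Q \<ge> 0" and C: "C \<ge> 0" by (auto simp: Q_def C_def)
  show ?thesis
  proof (rule that[of "Q * (C * (1 + \<rho>))"])
    show "Q * (C * (1 + \<rho>)) \<ge> 0" using Q C assms by simp
    fix \<sigma> T :: real assume \<sigma>: "\<sigma> \<in> {5/6 + \<rho>..b}" and T: "T \<ge> 0"
    have cont: "continuous_on {s. Re s \<in> {5/6..b + \<rho>}} ?F"
      by (rule continuous_zeta_reg_squared) simp
    have contM: "continuous_on A (\<lambda>t. ?M (Complex \<sigma> t))" for A
      by (rule continuous_on_circle_mean[OF cont]) (use assms \<sigma> in auto)
    have "integral {-T..T} (\<lambda>t. norm (nu_reg (Complex \<sigma> t))) \<le> integral {-T..T} (\<lambda>t. Q * ?M (Complex \<sigma> t))"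
    proof (rule integral_le)
      have "continuous_on {s. Re s \<in> {5/6..b + \<rho>}} (\<lambda>s. norm (nu_reg s))"
        by (intro continuous_on_norm holomorphic_on_imp_continuous_on
            holomorphic_on_subset[OF holomorphic_nu_reg]) auto
      thus "(\<lambda>t. norm (nu_reg (Complex \<sigma> t))) integrable_on {-T..T}"
        using \<sigma> assms by (intro integrable_continuous_interval
          continuous_on_vertical[where F = "\<lambda>s. norm (nu_reg s)" and a = "5/6" and b = "b + \<rho>"]) auto
      show "(\<lambda>t. Q * ?M (Complex \<sigma> t)) integrable_on {-T..T}"
        by (intro integrable_continuous_interval continuous_intros contM)
      fix t
      let ?s = "Complex \<sigma> t"
      have s: "Re ?s > 0" "Re ?s > \<rho>" using \<sigma> assms by auto
      show "norm (nu_reg ?s) \<le> Q * ?M ?s"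
        using norm_nu_reg_le[OF s(1)] norm_deriv_zeta_reg_squared_le[OF assms s(2), of 0]
          norm_deriv_zeta_reg_squared_le[OF assms s(2), of 1]
          norm_deriv_zeta_reg_squared_le[OF assms s(2), of 2]
        by (simp add: Q_def algebra_simps)
    qed
    also have "\<dots> = Q * integral {-T..T} (\<lambda>t. ?M (Complex \<sigma> t))" by simp
    also have "\<dots> \<le> Q * (C * (T + \<rho> + 1))"
      using \<sigma> assms T Q unfolding C_def
      by (intro mult_left_mono vertical_circle_mean_le[OF cont] zeta_reg_mean_square) auto
    also have "\<dots> \<le> Q * (C * ((1 + \<rho>) * (T + 1)))"
      using Q C T assms by (intro mult_left_mono) (auto simp: algebra_simps)
    finally show "integral {-T..T} (\<lambda>t. norm (nu_reg (Complex \<sigma> t))) \<le> Q * (C * (1 + \<rho>)) * (T + 1)"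
      by (simp only: mult_ac)
  qed
qed

text \<open>Since \<open>norm (s - 1) \<ge> norm (s + 1) - 2\<close>, the quotient is at least
  \<open>1 - 2 / y\<close> with \<open>y = norm (s + 1)\<close>, which increases with
  \<open>y \<ge> c + 1\<close>.\<close>

lemma norm_moebius_ge:
  assumes "c > 0" "Re s = c"
  shows "(c - 1) / (c + 1) \<le> norm ((s - 1) / (s + 1))"
proof -
  have n: "norm (s + 1) \<ge> c + 1" using complex_Re_le_cmod[of "s + 1"] assms by simp
  have "(c - 1) / (c + 1) = 1 - 2 / (c + 1)" using assms by (simp add: field_simps)
  also have "\<dots> \<le> 1 - 2 / norm (s + 1)"
    using n assms(1) by (intro diff_left_mono divide_left_mono mult_pos_pos) linarith+
  also have "\<dots> = (norm (s + 1) - 2) / norm (s + 1)"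
  proof -
    have "norm (s + 1) \<noteq> 0" using n assms(1) by linarith
    thus ?thesis by (simp add: diff_divide_distrib)
  qed
  also have "\<dots> \<le> norm (s - 1) / norm (s + 1)"
    using norm_triangle_ineq2[of "s + 1" 2] by (intro divide_right_mono) (auto simp: algebra_simps)
  finally show ?thesis by (simp add: norm_divide)
qed

theorem theorem3:
  fixes \<delta> :: real
  assumes "\<delta> > 0"
  shows "(\<forall>T. finite (nu_zeros (5/6 + \<delta>) T)) \<and>
         (\<lambda>T. real (nu_count (5/6 + \<delta>) T)) \<in> O[at_top](\<lambda>T. T)"
proof -
  define \<sigma> where "\<sigma> = 5/6 + \<delta>"
  obtain c0 where c0: "\<And>s. Re s \<ge> c0 \<Longrightarrow> (ln 2)\<^sup>2 / 2 * 2 powr (- Re s) \<le> norm (nu s)"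
    using nu_lower_bound by blast
  \<comment> \<open>The second entry ensures \<open>c > 1\<close>, so that \<open>\<kappa>\<close>
    is positive, and a positive inner radius.\<close>
  define c where "c = max c0 (2 + \<delta>)"
  have c: "c \<ge> c0" "c \<ge> 2 + \<delta>" by (auto simp: c_def)
  \<comment> \<open>The outer circles stay in \<open>Re s \<ge> 5/6 + \<delta> / 4\<close>, where
    the mean of \<open>nu_reg\<close> is controlled, and \<open>r = (c - \<sigma>) + \<eta>\<close>
    leaves the inner discs room for windows of half-length \<open>\<eta>\<close>.\<close>
  define R r \<eta> where "R = c - 5/6 - \<delta> / 4" and "r = c - 5/6 - \<delta> / 2" and "\<eta> = \<delta> / 2"
  define \<kappa> where "\<kappa> = ((c - 1) / (c + 1)) ^ 4 * ((ln 2)\<^sup>2 / 2 * 2 powr (- c))"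
  have \<kappa>: "\<kappa> > 0" using c assms by (simp add: \<kappa>_def)
  have nu_nz: "nu s \<noteq> 0" if "Re s \<ge> c" for s
  proof -
    have "0 < (ln 2)\<^sup>2 / 2 * 2 powr (- Re s)" by simp
    also have "\<dots> \<le> norm (nu s)" using that c by (intro c0) simp
    finally show ?thesis by auto
  qed
  have lower: "\<kappa> \<le> norm (nu_reg (Complex c t))" for t
  proof -
    have "nu_reg (Complex c t) = ((Complex c t - 1) / (Complex c t + 1)) ^ 4 * nu (Complex c t)"
      using c assms by (intro nu_reg_eq) (auto simp: complex_eq_iff)
    moreover have "\<kappa> \<le> norm ((Complex c t - 1) / (Complex c t + 1)) ^ 4 * norm (nu (Complex c t))"
      unfolding \<kappa>_def using c assms c0[of "Complex c t"]
      by (intro mult_mono power_mono norm_moebius_ge) auto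
    ultimately show ?thesis by (simp add: norm_mult norm_power)
  qed
  have nz: "nu_reg (of_real c) \<noteq> 0"
    using lower[of 0] \<kappa> by (auto simp: complex_of_real_def)
  have zeros: "Re s > 0" "s \<noteq> 1" "nu_reg s = 0" "\<sigma> \<le> Re s" "Re s \<le> c" "\<bar>Im s\<bar> \<le> T"
    if "s \<in> nu_zeros \<sigma> T" for s T
  proof -
    show "Re s \<le> c" using that nu_nz[of s] by (cases "c \<le> Re s") (auto simp: nu_zeros_def)
  qed (use that assms nu_reg_eq[of s] in \<open>auto simp: nu_zeros_def \<sigma>_def\<close>)
  \<comment> \<open>Nonvanishing beyond \<open>c\<close> confines the zeros to a compact rectangle.
    Finiteness makes the sum in \<open>nu_count\<close> a genuine count.\<close>
  have fin: "finite (nu_zeros \<sigma> T)" for T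
  proof (rule finite_subset)
    let ?K = "cbox (Complex \<sigma> (- T)) (Complex c T)"
    show "nu_zeros \<sigma> T \<subseteq> {z \<in> ?K. nu_reg z = 0}"
    proof
      fix s assume "s \<in> nu_zeros \<sigma> T"
      from zeros[OF this] show "s \<in> {z \<in> ?K. nu_reg z = 0}" by (auto simp: in_cbox_complex_iff)
    qed
    have sub: "?K \<subseteq> {s. Re s > 0}" using assms by (auto simp: in_cbox_complex_iff \<sigma>_def)
    show "finite {z \<in> ?K. nu_reg z = 0}"
    proof (cases "nu_reg constant_on {s. Re s > 0}")
      case True
      then obtain v where v: "\<And>s. Re s > 0 \<Longrightarrow> nu_reg s = v" by (auto simp: constant_on_def)
      hence "v \<noteq> 0" using nz v[of "of_real c"] c assms by auto
      hence "{z \<in> ?K. nu_reg z = 0} = {}" using sub v by auto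
      thus ?thesis by (simp only: finite.emptyI)
    next
      case False
      thus ?thesis
        using holomorphic_nu_reg sub
        by (intro holomorphic_compact_finite_zeros[of _ "{s. Re s > 0}"])
           (auto simp: open_halfspace_Re_gt convex_connected convex_halfspace_Re_gt)
    qed
  qed
  have \<rho>: "\<delta> / 4 > 0" using assms by simp
  obtain C where C: "C \<ge> 0" "\<And>\<sigma> T. \<sigma> \<in> {5/6 + \<delta> / 4..c + R} \<Longrightarrow> T \<ge> 0 \<Longrightarrow>
      integral {-T..T} (\<lambda>t. norm (nu_reg (Complex \<sigma> t))) \<le> C * (T + 1)"
    using nu_reg_mean[OF \<rho>, of "c + R"] by blast
  have r: "0 < r" "r < R" using c assms by (auto simp: R_def r_def)
  define B where "B = 2 * \<eta> * ln (R / r)"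
  have B: "B > 0" using r assms by (simp add: B_def \<eta>_def)
  have geo: "(c - \<sigma>)\<^sup>2 + \<eta>\<^sup>2 \<le> r\<^sup>2"
  proof -
    have "r\<^sup>2 = (c - \<sigma>)\<^sup>2 + \<eta>\<^sup>2 + 2 * (c - \<sigma>) * \<eta>"
      by (simp add: r_def \<sigma>_def \<eta>_def power2_eq_square field_simps)
    thus ?thesis using c assms by (simp add: \<sigma>_def \<eta>_def)
  qed
  have count: "B * real (nu_count \<sigma> T) \<le> C / \<kappa> * (T + \<eta> + R + 1)" if T: "T \<ge> 0" for T
  proof -
    have "nu_count \<sigma> T = (\<Sum>s\<in>nu_zeros \<sigma> T. nat (zorder nu_reg s))"
      unfolding nu_count_def
    proof (intro sum.cong refl arg_cong[where f = nat] zorder_nu_reg)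
      show "\<exists>w. Re w > 0 \<and> nu_reg w \<noteq> 0"
        using nz c assms by (intro exI[of _ "of_real c"]) auto
    qed (use zeros in blast)+
    moreover have "2 * \<eta> * ln (R / r) * real (\<Sum>s\<in>nu_zeros \<sigma> T. nat (zorder nu_reg s))
        \<le> C / \<kappa> * (T + \<eta> + R + 1)"
    proof (rule zero_count_le_vertical_mean[OF holomorphic_nu_reg _ r _ geo \<kappa> lower _ fin _ T])
      show "0 < c - R" "\<eta> > 0" using assms by (auto simp: R_def \<eta>_def)
      show "integral {-T..T} (\<lambda>t. norm (nu_reg (Complex \<sigma> t))) \<le> C * (T + 1)"
        if "\<sigma> \<in> {c - R..c + R}" "T \<ge> 0" for \<sigma> T
        using that by (intro C) (auto simp: R_def)
      show "\<sigma> \<le> Re a \<and> Re a \<le> c \<and> \<bar>Im a\<bar> \<le> T" if "a \<in> nu_zeros \<sigma> T" for a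
        using zeros[OF that] by simp
    qed
    ultimately show ?thesis by (simp add: B_def)
  qed
  have "(\<lambda>T. real (nu_count \<sigma> T)) \<in> O[at_top](\<lambda>T. T)"
  proof (rule bigoI)
    show "\<forall>\<^sub>F T in at_top. norm (real (nu_count \<sigma> T)) \<le> C / \<kappa> * (2 + \<eta> + R) / B * norm T"
      using eventually_ge_at_top[of "1::real"]
    proof eventually_elim
      case (elim T)
      \<comment> \<open>For \<open>T \<ge> 1\<close> the additive constants are absorbed into a
        multiple of \<open>T\<close>; this product is exactly the difference of the two
        sides.\<close>
      have "0 \<le> (1 + \<eta> + R) * (T - 1)"
        using elim r assms by (intro mult_nonneg_nonneg) (auto simp: \<eta>_def)
      hence "T + \<eta> + R + 1 \<le> (2 + \<eta> + R) * T" by (simp add: algebra_simps)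
      hence "C / \<kappa> * (T + \<eta> + R + 1) \<le> C / \<kappa> * ((2 + \<eta> + R) * T)"
        using C \<kappa> by (intro mult_left_mono) auto
      hence "B * real (nu_count \<sigma> T) \<le> C / \<kappa> * (2 + \<eta> + R) * T"
        using count[of T] elim by (simp only: mult.assoc) linarith
      hence "real (nu_count \<sigma> T) \<le> C / \<kappa> * (2 + \<eta> + R) * T / B"
        by (subst pos_le_divide_eq[OF B]) (simp only: mult.commute[of B])
      thus ?case using elim by simp
    qed
  qed
  thus ?thesis using fin by (simp add: \<sigma>_def)
qed

end
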